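(* Let $P\subset\mathbb{R}^d$ be a $d$-dimensional convex polytope (with the origin in its interior). If $P$ is second-order rigid, then $P$ is rigid.
   Context: Let $P$ have vertex set $V$, edge set $E$ and facet set $F$, and write $i\sim\sigma$ if vertex $i$ lies on facet $\sigma$. The realization space of the combinatorial type $\mathcal P=(V,E,F,\sim)$ of $P$ is the set $\mathrm{REAL}(\mathcal P)$ of pairs $(\boldsymbol p,\boldsymbol a)$ of maps $\boldsymbol p:V\to\mathbb{R}^d$, $\boldsymbol a:F\to\mathbb{R}^d$ with $\langle p_i,a_\sigma\rangle=1$ whenever $i\sim\sigma$ and $\langle p_i,a_\sigma\rangle<1$ whenever $i\not\sim\sigma$. $P$ is identified with the element $(\boldsymbol p,\boldsymbol a)\in\mathrm{REAL}(\mathcal P)$ given by its vertices $p_i$ and suitably scaled outward facet normals $a_\sigma$. Rigidity: two realizations are equivalent if the distances $\|p_i-p_j\|$ agree for all edges $ij\in E$, and congruent if they agree for all pairs $i,j\in V$. A motion of $P$ is a continuous map $[0,1]\to\mathrm{REAL}(\mathcal P)$, starting at $P$, all of whose values are equivalent to $P$; it is trivial if all its values are congruent to $P$. $P$ is rigid if all its motions are trivial. First-order motions: a first-order motion of $P$ is a pair $(\dot{\boldsymbol p},\dot{\boldsymbol a})$ of maps $\dot{\boldsymbol p}:V\to\mathbb{R}^d$, $\dot{\boldsymbol a}:F\to\mathbb{R}^d$ with $\langle p_i-p_j,\dot p_i-\dot p_j\rangle=0$ for all $ij\in E$ and $\langle p_i,\dot a_\sigma\rangle+\langle\dot p_i,a_\sigma\rangle=0$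 for all $i\sim\sigma$. It is trivial if $\langle p_i-p_j,\dot p_i-\dot p_j\rangle=0$ for all $i,j\in V$. Second-order rigidity: a second-order motion of $P$ is a tuple $(\dot{\boldsymbol p},\dot{\boldsymbol a};\ddot{\boldsymbol p},\ddot{\boldsymbol a})$ of maps $\dot{\boldsymbol p},\ddot{\boldsymbol p}:V\to\mathbb{R}^d$, $\dot{\boldsymbol a},\ddot{\boldsymbol a}:F\to\mathbb{R}^d$ such that $(\dot{\boldsymbol p},\dot{\boldsymbol a})$ is a first-order motion, $\langle p_i-p_j,\ddot p_i-\ddot p_j\rangle+\langle\dot p_i-\dot p_j,\dot p_i-\dot p_j\rangle=0$ for all $ij\in E$, and $\langle p_i,\ddot a_\sigma\rangle+2\langle\dot p_i,\dot a_\sigma\rangle+\langle\ddot p_i,a_\sigma\rangle=0$ for all $i\sim\sigma$. It is trivial if $(\dot{\boldsymbol p},\dot{\boldsymbol a})$ is trivial as a first-order motion. $P$ is second-order rigid if all its second-order motions are trivial. *)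

theory Defs
  imports "HOL-Analysis.Analysis"
begin

text \<open>An edge \<open>ij\<close> is stored as the unordered pair \<open>{i, j}\<close>.\<close>

record ('v, 'f) comb_type =
  verts :: "'v set"
  edges :: "'v set set"
  facets :: "'f set"
  incident :: "'v \<Rightarrow> 'f \<Rightarrow> bool"

type_synonym ('v, 'f, 'a) config = "('v \<Rightarrow> 'a) \<times> ('f \<Rightarrow> 'a)"

text \<open>
  Maps defined on \<open>V\<close> and on \<open>F\<close> are total functions that are \<open>undefined\<close> elsewhere
  (\<open>extensional\<close>). The product topology on functions then induces on this set the
  topology of \<open>(\<real>\<^sup>d)\<^sup>V \<times> (\<real>\<^sup>d)\<^sup>F\<close>.
\<close>

definition realizations :: "('v, 'f) comb_type \<Rightarrow> ('v, 'f, 'a::euclidean_space) config set" where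
  "realizations K = {(p, a).
     p \<in> extensional (verts K) \<and> a \<in> extensional (facets K) \<and>
     (\<forall>i \<in> verts K. \<forall>\<sigma> \<in> facets K.
        (incident K i \<sigma> \<longrightarrow> p i \<bullet> a \<sigma> = 1) \<and> (\<not> incident K i \<sigma> \<longrightarrow> p i \<bullet> a \<sigma> < 1))}"

definition equivalent ::
  "('v, 'f) comb_type \<Rightarrow> ('v, 'f, 'a::euclidean_space) config \<Rightarrow> ('v, 'f, 'a) config \<Rightarrow> bool" where
  "equivalent K r s \<longleftrightarrow>
     (\<forall>i j. {i, j} \<in> edges K \<longrightarrow> norm (fst r i - fst r j) = norm (fst s i - fst s j))"

definition congruent_conf ::
  "('v, 'f) comb_type \<Rightarrow> ('v, 'f, 'a::euclidean_space) config \<Rightarrow> ('v, 'f, 'a) config \<Rightarrow> bool" where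
  "congruent_conf K r s \<longleftrightarrow>
     (\<forall>i \<in> verts K. \<forall>j \<in> verts K. norm (fst r i - fst r j) = norm (fst s i - fst s j))"

definition motion ::
  "('v, 'f) comb_type \<Rightarrow> ('v, 'f, 'a::euclidean_space) config \<Rightarrow>
   (real \<Rightarrow> ('v, 'f, 'a) config) \<Rightarrow> bool" where
  "motion K r \<gamma> \<longleftrightarrow>
     path \<gamma> \<and> path_image \<gamma> \<subseteq> realizations K \<and> pathstart \<gamma> = r \<and>
     (\<forall>t \<in> {0..1}. equivalent K (\<gamma> t) r)"

definition trivial_motion ::
  "('v, 'f) comb_type \<Rightarrow> ('v, 'f, 'a::euclidean_space) config \<Rightarrow>
   (real \<Rightarrow> ('v, 'f, 'a) config) \<Rightarrow> bool" where
  "trivial_motion K r \<gamma> \<longleftrightarrow> (\<forall>t \<in> {0..1}. congruent_conf K (\<gamma> t) r)"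

definition rigid :: "('v, 'f) comb_type \<Rightarrow> ('v, 'f, 'a::euclidean_space) config \<Rightarrow> bool" where
  "rigid K r \<longleftrightarrow> (\<forall>\<gamma>. motion K r \<gamma> \<longrightarrow> trivial_motion K r \<gamma>)"

text \<open>Only the values of the velocities \<open>p', p''\<close> on \<open>V\<close> and \<open>a', a''\<close> on \<open>F\<close> matter here.\<close>

definition first_order_motion ::
  "('v, 'f) comb_type \<Rightarrow> ('v, 'f, 'a::euclidean_space) config \<Rightarrow> ('v, 'f, 'a) config \<Rightarrow> bool" where
  "first_order_motion K = (\<lambda>(p, a) (p', a').
     (\<forall>i j. {i, j} \<in> edges K \<longrightarrow> (p i - p j) \<bullet> (p' i - p' j) = 0) \<and>
     (\<forall>i \<in> verts K. \<forall>\<sigma> \<in> facets K. incident K i \<sigma> \<longrightarrow> p i \<bullet> a' \<sigma> + p' i \<bullet> a \<sigma> = 0))"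

definition trivial_first_order ::
  "('v, 'f) comb_type \<Rightarrow> ('v, 'f, 'a::euclidean_space) config \<Rightarrow> ('v, 'f, 'a) config \<Rightarrow> bool" where
  "trivial_first_order K = (\<lambda>(p, a) (p', a').
     \<forall>i \<in> verts K. \<forall>j \<in> verts K. (p i - p j) \<bullet> (p' i - p' j) = 0)"

definition second_order_motion ::
  "('v, 'f) comb_type \<Rightarrow> ('v, 'f, 'a::euclidean_space) config \<Rightarrow>
   ('v, 'f, 'a) config \<Rightarrow> ('v, 'f, 'a) config \<Rightarrow> bool" where
  "second_order_motion K = (\<lambda>(p, a) (p', a') (p'', a'').
     first_order_motion K (p, a) (p', a') \<and>
     (\<forall>i j. {i, j} \<in> edges K \<longrightarrow>
        (p i - p j) \<bullet> (p'' i - p'' j) + (p' i - p' j) \<bullet> (p' i - p' j) = 0) \<and>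
     (\<forall>i \<in> verts K. \<forall>\<sigma> \<in> facets K. incident K i \<sigma> \<longrightarrow>
        p i \<bullet> a'' \<sigma> + 2 * (p' i \<bullet> a' \<sigma>) + p'' i \<bullet> a \<sigma> = 0))"

definition second_order_rigid ::
  "('v, 'f) comb_type \<Rightarrow> ('v, 'f, 'a::euclidean_space) config \<Rightarrow> bool" where
  "second_order_rigid K r \<longleftrightarrow>
     (\<forall>v w. second_order_motion K r v w \<longrightarrow> trivial_first_order K r v)"

definition polytope_type :: "'a::euclidean_space set \<Rightarrow> ('a, 'a set) comb_type" where
  "polytope_type P = \<lparr>
     verts = {x. x extreme_point_of P},
     edges = {{x, y} | x y. x extreme_point_of P \<and> y extreme_point_of P \<and>
                            closed_segment x y edge_of P},
     facets = {\<sigma>. \<sigma> facet_of P},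
     incident = (\<in>)\<rparr>"

text \<open>
  The outward normal of the facet \<open>\<sigma>\<close>, scaled so that \<open>\<sigma>\<close> lies in the hyperplane
  \<open>a \<bullet> x = 1\<close>; it exists and is unique if the origin is interior to \<open>P\<close>
  (\<open>ex1_facet_normal\<close> below).
\<close>

definition facet_normal :: "'a::euclidean_space set \<Rightarrow> 'a set \<Rightarrow> 'a" where
  "facet_normal P \<sigma> = (THE a. P \<subseteq> {x. a \<bullet> x \<le> 1} \<and> \<sigma> = P \<inter> {x. a \<bullet> x = 1})"

definition polytope_realization :: "'a::euclidean_space set \<Rightarrow> ('a, 'a set, 'a) config" where
  "polytope_realization P =
     (restrict (\<lambda>x. x) {x. x extreme_point_of P}, restrict (facet_normal P) {\<sigma>. \<sigma> facet_of P})"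

lemma ex1_facet_normal:
  fixes P :: "'a::euclidean_space set"
  assumes P: "polytope P" and int: "0 \<in> interior P" and F: "\<sigma> facet_of P"
  shows "\<exists>!a. P \<subseteq> {x. a \<bullet> x \<le> 1} \<and> \<sigma> = P \<inter> {x. a \<bullet> x = 1}"
proof -
  obtain a b where ab: "a \<noteq> 0" "P \<subseteq> {x. a \<bullet> x \<le> b}" "\<sigma> = P \<inter> {x. a \<bullet> x = b}"
    using facet_of_polyhedron[OF polytope_imp_polyhedron[OF P] F] by metis
  obtain e where e: "e > 0" "cball 0 e \<subseteq> P"
    using int mem_interior_cball by blast
  have "(e / norm a) *\<^sub>R a \<in> P"
    using e ab(1) by (intro subsetD[OF e(2)]) auto
  then have "(e / norm a) * (a \<bullet> a) \<le> b"
    using ab(2) by auto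
  moreover have "(e / norm a) * (a \<bullet> a) > 0"
    using e(1) ab(1) by simp
  ultimately have b: "b > 0" by linarith
  have ex: "P \<subseteq> {x. (a /\<^sub>R b) \<bullet> x \<le> 1} \<and> \<sigma> = P \<inter> {x. (a /\<^sub>R b) \<bullet> x = 1}"
    using ab b by (auto simp: field_simps)
  have "aff_dim P = DIM('a)"
    using int by (metis aff_dim_nonempty_interior empty_iff)
  then have dim\<sigma>: "aff_dim \<sigma> = int DIM('a) - 1"
    using F by (simp add: facet_of_def)
  have "affine hull \<sigma> \<subseteq> {x. a \<bullet> x = b}"
    using ab(3) by (intro hull_minimal) (auto simp: affine_hyperplane)
  then have "0 \<notin> affine hull \<sigma>"
    using b by auto
  then have "aff_dim (insert 0 \<sigma>) = DIM('a)"
    using dim\<sigma> by (simp add: aff_dim_insert)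
  then have "dim (insert 0 \<sigma>) = DIM('a)"
    by (simp add: aff_dim_zero hull_inc)
  then have span: "span \<sigma> = UNIV"
    by (simp add: dim_eq_full)
  show ?thesis
  proof (rule ex1I[where a = "a /\<^sub>R b"], rule ex)
    fix c assume c: "P \<subseteq> {x. c \<bullet> x \<le> 1} \<and> \<sigma> = P \<inter> {x. c \<bullet> x = 1}"
    have "(c - a /\<^sub>R b) \<bullet> x = 0" if "x \<in> \<sigma>" for x
      using that c ex by (auto simp: inner_diff_left)
    then have "(c - a /\<^sub>R b) \<bullet> x = 0" for x
      using orthogonal_to_span[of x \<sigma> "c - a /\<^sub>R b"] span by (auto simp: orthogonal_def)
    then show "c = a /\<^sub>R b"
      by (metis inner_eq_zero_iff right_minus_eq)
  qed
qed

lemma polytope_realization_in_realizations: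
  fixes P :: "'a::euclidean_space set"
  assumes P: "polytope P" and int: "0 \<in> interior P"
  shows "polytope_realization P \<in> realizations (polytope_type P)"
proof -
  have *: "P \<subseteq> {x. facet_normal P \<sigma> \<bullet> x \<le> 1} \<and> \<sigma> = P \<inter> {x. facet_normal P \<sigma> \<bullet> x = 1}"
    if "\<sigma> facet_of P" for \<sigma>
    unfolding facet_normal_def by (rule theI'[OF ex1_facet_normal[OF P int that]])
  have "(x \<in> \<sigma> \<longrightarrow> x \<bullet> facet_normal P \<sigma> = 1) \<and> (x \<notin> \<sigma> \<longrightarrow> x \<bullet> facet_normal P \<sigma> < 1)"
    if x: "x extreme_point_of P" and \<sigma>: "\<sigma> facet_of P" for x \<sigma>
  proof -
    have "x \<in> P" using x by (simp add: extreme_point_of_def)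
    then show ?thesis using *[OF \<sigma>] by (force simp: inner_commute less_le)
  qed
  then show ?thesis
    by (simp add: polytope_realization_def realizations_def polytope_type_def)
qed

end

theory Submission
  imports Defs
begin

text \<open>
  No curve selection is needed: a blow-up of a sequence suffices. The times at which a motion
  is an isometric copy of \<open>P\<close> form a closed set. If this set were not open in \<open>[0, 1]\<close>, there would be
  equivalent but not isometric realizations \<open>x\<^sub>n\<close> converging to an isometric copy of \<open>P\<close>.
  Move each \<open>x\<^sub>n\<close> by the isometry that brings its vertices closest to those of \<open>P\<close> in the least squares
  sense, so that \<open>x\<^sub>n\<close> tends to \<open>P\<close> and the difference \<open>u\<^sub>n\<close> is orthogonal to all infinitesimal
  isometries. The constraints are quadratic, \<open>2 B(P, u\<^sub>n) + B(u\<^sub>n, u\<^sub>n) = 0\<close>; hence a limit \<open>v\<close> of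
  \<open>u\<^sub>n / \<bar>u\<^sub>n\<bar>\<close> satisfies \<open>B(P, v) = 0\<close>, and \<open>B(v, v)\<close> lies in the image of \<open>B(P, _)\<close>, since that image
  is closed. So \<open>v\<close> extends to a second-order motion and is trivial by assumption, which forces \<open>v = 0\<close>
  because \<open>v\<close> is orthogonal to the infinitesimal isometries.
\<close>

section \<open>Compactness for finite families and closed images of linear maps\<close>

text \<open>Bolzano-Weierstrass, passing to a further subsequence for each index in turn. Only the
  values on \<open>I\<close> are controlled, which suits configurations stored as total
  functions.\<close>

lemma finite_family_convergent_subsequence:
  fixes f :: "nat \<Rightarrow> 'i \<Rightarrow> 'b::heine_borel"
  assumes "finite I" and "\<And>i. i \<in> I \<Longrightarrow> bounded (range (\<lambda>n. f n i))"
  shows "\<exists>l r. strict_mono r \<and> (\<forall>i\<in>I. (\<lambda>n. f (r n) i) \<longlonglongrightarrow> l i)"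
  using assms
proof (induction I)
  case empty
  show ?case by (intro exI[of _ "id::nat \<Rightarrow> nat"] exI) (auto simp: strict_mono_def)
next
  case (insert a I)
  then obtain l and r :: "nat \<Rightarrow> nat"
    where r: "strict_mono r" "\<forall>i\<in>I. (\<lambda>n. f (r n) i) \<longlonglongrightarrow> l i" by blast
  have "bounded (range (\<lambda>n. f (r n) a))"
    by (rule bounded_subset[OF insert.prems[of a]]) auto
  then obtain m s where s: "strict_mono s" "((\<lambda>n. f (r n) a) \<circ> s) \<longlonglongrightarrow> m"
    using bounded_imp_convergent_subsequence by blast
  have "strict_mono (r \<circ> s)" using r s by (simp add: strict_mono_o)
  moreover have "\<forall>i\<in>insert a I. (\<lambda>n. f ((r \<circ> s) n) i) \<longlonglongrightarrow> (l(a := m)) i"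
    using insert.hyps(2) s(2) LIMSEQ_subseq_LIMSEQ[OF _ s(1)] r(2)
    by (auto simp: o_def)
  ultimately show ?case by blast
qed

text \<open>A finitely generated span is closed, shown by removing one generator \<open>a\<close>.
  If \<open>w a\<close> is a combination of the others on \<open>I\<close>, its coefficients are
  absorbed by theirs. Otherwise the coefficients of \<open>a\<close> must be bounded: dividing by
  unbounded ones would exhibit \<open>w a\<close> as a limit of combinations of the others, hence as
  such a combination by the induction hypothesis.\<close>

lemma closed_span_pointwise_scalar:
  fixes w :: "'j \<Rightarrow> 'k \<Rightarrow> real"
  assumes "finite J" "finite I"
    and "\<And>k. k \<in> I \<Longrightarrow> (\<lambda>n. \<Sum>j\<in>J. c n j * w j k) \<longlonglongrightarrow> y k"
  shows "\<exists>d. \<forall>k\<in>I. y k = (\<Sum>j\<in>J. d j * w j k)"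
  using assms(1) assms(3)
proof (induction J arbitrary: c y)
  case empty
  then show ?case by (auto simp: LIMSEQ_const_iff)
next
  case (insert a J)
  have split: "(\<Sum>j\<in>insert a J. c n j * w j k) = c n a * w a k + (\<Sum>j\<in>J. c n j * w j k)" for n k
    using insert.hyps by simp
  have lim: "(\<lambda>n. c n a * w a k + (\<Sum>j\<in>J. c n j * w j k)) \<longlonglongrightarrow> y k" if "k \<in> I" for k
    using insert.prems[OF that] by (simp add: split)
  \<comment> \<open>Once the coefficients of \<open>a\<close> converge along a subsequence, their
    contribution moves to the left-hand side and the induction hypothesis handles the
    remainder.\<close>
  have reduce: ?case
    if bd: "bounded (range (\<lambda>n. c n a))"
  proof -
    obtain m s where s: "strict_mono s" "((\<lambda>n. c n a) \<circ> s) \<longlonglongrightarrow> m"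
      using bounded_imp_convergent_subsequence[OF bd] by blast
    have "(\<lambda>n. \<Sum>j\<in>J. c (s n) j * w j k) \<longlonglongrightarrow> y k - m * w a k" if "k \<in> I" for k
    proof -
      have "(\<lambda>n. (c (s n) a * w a k + (\<Sum>j\<in>J. c (s n) j * w j k)) - c (s n) a * w a k)
              \<longlonglongrightarrow> y k - m * w a k"
        using LIMSEQ_subseq_LIMSEQ[OF lim[OF that] s(1)] s(2)
        by (intro tendsto_diff tendsto_mult tendsto_const) (auto simp: o_def)
      then show ?thesis by simp
    qed
    then obtain d where d: "\<forall>k\<in>I. y k - m * w a k = (\<Sum>j\<in>J. d j * w j k)"
      using insert.IH[of "\<lambda>n. c (s n)" "\<lambda>k. y k - m * w a k"] by blast
    have "(\<Sum>j\<in>insert a J. (d(a := m)) j * w j k) = m * w a k + (\<Sum>j\<in>J. d j * w j k)" for k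
      using insert.hyps by (auto intro!: sum.cong)
    then have "\<forall>k\<in>I. y k = (\<Sum>j\<in>insert a J. (d(a := m)) j * w j k)" using d by force
    then show ?thesis by blast
  qed
  show ?case
  proof (cases "\<exists>e. \<forall>k\<in>I. w a k = (\<Sum>j\<in>J. e j * w j k)")
    case True
    then obtain e where e: "\<forall>k\<in>I. w a k = (\<Sum>j\<in>J. e j * w j k)" by blast
    have "(\<lambda>n. \<Sum>j\<in>J. (c n j + c n a * e j) * w j k) \<longlonglongrightarrow> y k" if "k \<in> I" for k
      using lim[OF that] e that
      by (simp add: sum.distrib distrib_right sum_distrib_left algebra_simps)
    from insert.IH[OF this] obtain d where d: "\<forall>k\<in>I. y k = (\<Sum>j\<in>J. d j * w j k)" by blast
    have "(\<Sum>j\<in>insert a J. (d(a := 0)) j * w j k) = (\<Sum>j\<in>J. d j * w j k)" for k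
      using insert.hyps by (auto intro!: sum.cong)
    then show ?thesis using d by (intro exI[of _ "d(a := 0)"]) simp
  next
    case False
    have "bounded (range (\<lambda>n. c n a))"
    proof (rule ccontr)
      assume "\<not> bounded (range (\<lambda>n. c n a))"
      then have "\<exists>N. \<bar>c N a\<bar> > real n" for n
        by (auto simp: bounded_iff not_le)
      \<comment> \<open>\<open>s\<close> need not be increasing: below, \<open>Y\<close> is bounded
        as a whole sequence, and so along any choice of indices.\<close>
      then obtain s where s: "\<And>n. \<bar>c (s n) a\<bar> > real n" by metis
      have nz: "c (s n) a \<noteq> 0" for n using s[of n] by auto
      have inv0: "(\<lambda>n. inverse (c (s n) a)) \<longlonglongrightarrow> 0"
      proof (rule Lim_null_comparison)
        show "(\<lambda>n. inverse (real n)) \<longlonglongrightarrow> 0" by (rule lim_inverse_n)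
        show "\<forall>\<^sub>F n in sequentially. norm (inverse (c (s n) a)) \<le> inverse (real n)"
          using eventually_gt_at_top[of 0]
        proof eventually_elim
          case (elim n)
          then show ?case using s[of n] by (simp add: abs_inverse le_imp_inverse_le)
        qed
      qed
      have "(\<lambda>n. \<Sum>j\<in>J. (- c (s n) j / c (s n) a) * w j k) \<longlonglongrightarrow> w a k" if k: "k \<in> I" for k
      proof -
        define Y where "Y n = c n a * w a k + (\<Sum>j\<in>J. c n j * w j k)" for n
        have "Bseq Y"
          unfolding Y_def using lim[OF k] by (intro convergent_imp_Bseq) (auto simp: convergent_def)
        then have "Bfun (\<lambda>n. Y (s n)) sequentially"
          by (auto simp: Bseq_def)
        then have "(\<lambda>n. inverse (c (s n) a) * Y (s n)) \<longlonglongrightarrow> 0"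
          using inv0 bounded_bilinear.Zfun_prod_Bfun[OF bounded_bilinear_mult]
          by (simp add: tendsto_Zfun_iff)
        then have "(\<lambda>n. w a k - inverse (c (s n) a) * Y (s n)) \<longlonglongrightarrow> w a k - 0"
          by (intro tendsto_diff tendsto_const)
        moreover have "w a k - inverse (c (s n) a) * Y (s n)
            = (\<Sum>j\<in>J. (- c (s n) j / c (s n) a) * w j k)" for n
        proof -
          have "(\<Sum>j\<in>J. (- c (s n) j / c (s n) a) * w j k)
              = - inverse (c (s n) a) * (\<Sum>j\<in>J. c (s n) j * w j k)"
            by (simp add: sum_distrib_left divide_inverse algebra_simps sum_negf)
          then show ?thesis using nz[of n] by (simp add: Y_def field_simps)
        qed
        ultimately show ?thesis by simp
      qed
      from insert.IH[OF this] False show False by blast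
    qed
    then show ?thesis by (rule reduce)
  qed
qed

text \<open>Coordinates turn vector unknowns into scalar coefficients indexed by
  \<open>J \<times> Basis\<close>. The lemma provides the second-order part of a motion: a
  right-hand side that is a limit of attained values is itself attained, although the
  \<open>x n\<close> may diverge.\<close>

lemma closed_linear_image_pointwise:
  fixes w :: "'j \<Rightarrow> 'k \<Rightarrow> 'a::euclidean_space"
  assumes "finite J" "finite I"
    and lim: "\<And>k. k \<in> I \<Longrightarrow> (\<lambda>n. \<Sum>j\<in>J. w j k \<bullet> x n j) \<longlonglongrightarrow> y k"
  shows "\<exists>z. \<forall>k\<in>I. y k = (\<Sum>j\<in>J. w j k \<bullet> z j)"
proof -
  have expand: "(\<Sum>j\<in>J. w j k \<bullet> u j)
      = (\<Sum>(j, b)\<in>J \<times> Basis. (u j \<bullet> b) * (w j k \<bullet> b))" for u :: "'j \<Rightarrow> 'a" and k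
  proof -
    have "(\<Sum>j\<in>J. w j k \<bullet> u j) = (\<Sum>j\<in>J. \<Sum>b\<in>Basis. (u j \<bullet> b) * (w j k \<bullet> b))"
      by (intro sum.cong refl, subst euclidean_inner) (simp add: mult.commute)
    then show ?thesis by (simp add: sum.cartesian_product)
  qed
  have "\<exists>d. \<forall>k\<in>I. y k = (\<Sum>j\<in>J \<times> Basis. d j * (w (fst j) k \<bullet> snd j))"
    by (rule closed_span_pointwise_scalar[where c = "\<lambda>n j. x n (fst j) \<bullet> snd j"])
      (use assms in \<open>auto simp: expand case_prod_unfold\<close>)
  then obtain d where d: "\<forall>k\<in>I. y k = (\<Sum>j\<in>J \<times> Basis. d j * (w (fst j) k \<bullet> snd j))" by blast
  define z where "z j = (\<Sum>b\<in>Basis. d (j, b) *\<^sub>R b)" for j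
  have "z j \<bullet> b = d (j, b)" if "b \<in> Basis" for j b
    using that by (simp add: z_def inner_sum_left inner_Basis if_distrib sum.delta cong: if_cong)
  then have "\<forall>k\<in>I. y k = (\<Sum>j\<in>J. w j k \<bullet> z j)"
    using d by (auto simp: expand case_prod_unfold intro!: sum.cong)
  then show ?thesis by blast
qed

section \<open>Infinitesimal isometries and the symmetric moment condition\<close>

text \<open>A trivial velocity without translation part has the form
  \<open>\<pi> i = A (P i)\<close> with \<open>A\<close> skew. Let \<open>M\<close> be the moment
  matrix, the sum of the \<open>P i\<close> times their transposes; it is positive definite by
  \<open>span\<close>. The condition \<open>sym\<close> says that \<open>A M\<close> is symmetric,
  that is \<open>A M + M A = 0\<close>, and this forces \<open>A = 0\<close>. The proof carries out
  this argument with inner products and never constructs \<open>A\<close>.\<close>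

lemma symmetric_moment_trivial_imp_zero:
  fixes P \<pi> :: "'v \<Rightarrow> 'a::euclidean_space"
  assumes V: "finite V" and sumP: "(\<Sum>i\<in>V. P i) = 0" and sum\<pi>: "(\<Sum>i\<in>V. \<pi> i) = 0"
    and sym: "\<And>x y. (\<Sum>i\<in>V. (\<pi> i \<bullet> x) * (P i \<bullet> y)) = (\<Sum>i\<in>V. (\<pi> i \<bullet> y) * (P i \<bullet> x))"
    and triv: "\<And>i j. i \<in> V \<Longrightarrow> j \<in> V \<Longrightarrow> (P i - P j) \<bullet> (\<pi> i - \<pi> j) = 0"
    and span: "\<And>z. (\<And>i. i \<in> V \<Longrightarrow> z \<bullet> P i = 0) \<Longrightarrow> z = 0"
    and k: "k \<in> V"
  shows "\<pi> k = 0"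
proof -
  have e: "P i \<bullet> \<pi> i + P j \<bullet> \<pi> j = P i \<bullet> \<pi> j + P j \<bullet> \<pi> i" if "i \<in> V" "j \<in> V" for i j
    using triv[OF that] by (simp add: algebra_simps)
  define N where "N = real (card V)"
  have N: "N > 0" using V k by (auto simp: N_def card_gt_0_iff)
  \<comment> \<open>Summing \<open>e\<close> over \<open>j\<close> removes the mixed terms, since
    both families sum to zero. A second sum over \<open>i\<close> then gives the vanishing of every
    \<open>P i \<bullet> \<pi> i\<close>, and \<open>e\<close> becomes the skewness of the matrix of
    all \<open>\<pi> i \<bullet> P j\<close>.\<close>
  have s1: "N * (P i \<bullet> \<pi> i) + (\<Sum>j\<in>V. P j \<bullet> \<pi> j) = 0" if i: "i \<in> V" for i
  proof -
    have "(\<Sum>j\<in>V. P i \<bullet> \<pi> i + P j \<bullet> \<pi> j) = (\<Sum>j\<in>V. P i \<bullet> \<pi> j + P j \<bullet> \<pi> i)"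
      using e i by (intro sum.cong) auto
    also have "\<dots> = P i \<bullet> (\<Sum>j\<in>V. \<pi> j) + (\<Sum>j\<in>V. P j) \<bullet> \<pi> i"
      by (simp add: sum.distrib inner_sum_left inner_sum_right)
    finally show ?thesis by (simp add: sumP sum\<pi> sum.distrib N_def)
  qed
  have "(\<Sum>i\<in>V. N * (P i \<bullet> \<pi> i) + (\<Sum>j\<in>V. P j \<bullet> \<pi> j)) = 0"
    using s1 by simp
  then have "2 * N * (\<Sum>j\<in>V. P j \<bullet> \<pi> j) = 0"
    by (simp add: sum.distrib sum_distrib_left[symmetric] N_def[symmetric])
  then have "(\<Sum>j\<in>V. P j \<bullet> \<pi> j) = 0" using N by simp
  then have diag: "P i \<bullet> \<pi> i = 0" if "i \<in> V" for i
    using s1[OF that] N by simp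
  have skew: "\<pi> i \<bullet> P j = - (\<pi> j \<bullet> P i)" if "i \<in> V" "j \<in> V" for i j
    using e[OF that] diag that by (simp add: inner_commute)
  \<comment> \<open>\<open>g k\<close> is the moment matrix applied to
    \<open>\<pi> k\<close>.\<close>
  define g where "g k = (\<Sum>j\<in>V. (\<pi> k \<bullet> P j) *\<^sub>R P j)" for k
  have g: "g k \<bullet> x = (\<Sum>j\<in>V. (\<pi> k \<bullet> P j) * (P j \<bullet> x))" for k x
    by (simp add: g_def inner_sum_left)
  have gx: "g k \<bullet> x = - (\<Sum>i\<in>V. (\<pi> i \<bullet> x) * (P i \<bullet> P k))" if "k \<in> V" for k x
  proof -
    have "g k \<bullet> x = - (\<Sum>i\<in>V. (\<pi> i \<bullet> P k) * (P i \<bullet> x))"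
      unfolding g sum_negf[symmetric] by (intro sum.cong refl) (simp add: skew[OF that])
    then show ?thesis by (simp only: sym[of "P k" x])
  qed
  \<comment> \<open>Skewness and \<open>sym\<close> turn this sum of squares into minus another sum
    of squares, so it is zero.\<close>
  have "(\<Sum>k\<in>V. g k \<bullet> g k) = - (\<Sum>k\<in>V. \<Sum>i\<in>V. (g k \<bullet> \<pi> i) * (P i \<bullet> P k))"
    unfolding sum_negf[symmetric] by (intro sum.cong refl) (subst gx, auto simp: sum_negf inner_commute)
  also have "(\<Sum>k\<in>V. \<Sum>i\<in>V. (g k \<bullet> \<pi> i) * (P i \<bullet> P k))
     = (\<Sum>k\<in>V. \<Sum>i\<in>V. \<Sum>j\<in>V. (\<pi> k \<bullet> P j) * (P j \<bullet> \<pi> i) * (P i \<bullet> P k))"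
    by (simp add: g sum_distrib_right)
  also have "\<dots> = (\<Sum>j\<in>V. \<Sum>k\<in>V. \<Sum>i\<in>V. (\<pi> k \<bullet> P j) * (P j \<bullet> \<pi> i) * (P i \<bullet> P k))"
    by (subst (2) sum.swap, subst sum.swap) rule
  also have "\<dots> = (\<Sum>j\<in>V. (\<Sum>i\<in>V. (\<pi> i \<bullet> P j) *\<^sub>R P i) \<bullet> (\<Sum>i\<in>V. (\<pi> i \<bullet> P j) *\<^sub>R P i))"
    by (intro sum.cong refl, subst sum.swap)
      (simp add: inner_sum_left inner_sum_right inner_commute mult.assoc sum_distrib_left)
  finally have "(\<Sum>k\<in>V. g k \<bullet> g k) \<le> 0"
    using sum_nonneg[of V "\<lambda>j. (\<Sum>i\<in>V. (\<pi> i \<bullet> P j) *\<^sub>R P i) \<bullet> (\<Sum>i\<in>V. (\<pi> i \<bullet> P j) *\<^sub>R P i)"]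
    by simp
  moreover have "(\<Sum>k\<in>V. g k \<bullet> g k) \<ge> 0" by (intro sum_nonneg) simp
  ultimately have "(\<Sum>k\<in>V. g k \<bullet> g k) = 0" by simp
  then have "g k = 0"
    using sum_nonneg_eq_0_iff[OF V, of "\<lambda>k. g k \<bullet> g k"] k by simp
  \<comment> \<open>Pairing \<open>g k = 0\<close> with \<open>\<pi> k\<close> yields a vanishing
    sum of squares, which is the definiteness of the moment matrix.\<close>
  then have "(\<Sum>j\<in>V. (\<pi> k \<bullet> P j) * (\<pi> k \<bullet> P j)) = 0"
    using g[of k "\<pi> k"] by (simp add: inner_commute)
  then have "\<pi> k \<bullet> P j = 0" if "j \<in> V" for j
    using sum_nonneg_eq_0_iff[OF V, of "\<lambda>j. (\<pi> k \<bullet> P j) * (\<pi> k \<bullet> P j)"] that by simp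
  then show ?thesis by (rule span)
qed

section \<open>Least squares alignment by orthogonal maps\<close>

text \<open>Compactness of the orthogonal group: images of basis vectors have norm 1, so a
  subsequence converges on the basis and then everywhere by linearity. Inner products pass to the
  limit.\<close>

lemma orthogonal_transformation_convergent_subsequence:
  fixes R :: "nat \<Rightarrow> 'a::euclidean_space \<Rightarrow> 'a"
  assumes R: "\<And>n. orthogonal_transformation (R n)"
  shows "\<exists>T r. strict_mono r \<and> orthogonal_transformation T \<and> (\<forall>x. (\<lambda>n. R (r n) x) \<longlonglongrightarrow> T x)"
proof -
  have "bounded (range (\<lambda>n. R n b))" for b
    using R by (auto simp: bounded_iff orthogonal_transformation)
  then obtain l r where r: "strict_mono (r :: nat \<Rightarrow> nat)"
    and l: "\<And>b. b \<in> Basis \<Longrightarrow> (\<lambda>n. R (r n) b) \<longlonglongrightarrow> l b"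
    using finite_family_convergent_subsequence[of "Basis :: 'a set" R] by auto
  define T where "T x = (\<Sum>b\<in>Basis. (x \<bullet> b) *\<^sub>R l b)" for x
  have lin: "linear (R n)" for n using R orthogonal_transformation_linear by blast
  have T: "(\<lambda>n. R (r n) x) \<longlonglongrightarrow> T x" for x
  proof -
    have "R n x = (\<Sum>b\<in>Basis. (x \<bullet> b) *\<^sub>R R n b)" for n
      by (subst euclidean_representation[of x, symmetric])
        (simp add: linear_sum[OF lin] linear_cmul[OF lin])
    then show ?thesis unfolding T_def by (auto intro!: tendsto_intros l)
  qed
  have "T v \<bullet> T w = v \<bullet> w" for v w
  proof (rule LIMSEQ_unique)
    show "(\<lambda>n. R (r n) v \<bullet> R (r n) w) \<longlonglongrightarrow> T v \<bullet> T w" by (intro tendsto_inner T)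
    show "(\<lambda>n. R (r n) v \<bullet> R (r n) w) \<longlonglongrightarrow> v \<bullet> w"
      using R by (simp add: orthogonal_transformation_def)
  qed
  moreover have "linear T"
    by (rule linearI) (simp_all add: T_def inner_add_left scaleR_add_left sum.distrib scaleR_sum_right)
  ultimately have "orthogonal_transformation T" by (simp add: orthogonal_transformation_def)
  with r T show ?thesis by blast
qed

text \<open>The map is the rotation with cosine \<open>c\<close> and sine \<open>s\<close> in the
  plane of the orthonormal pair \<open>x\<close>, \<open>y\<close>, and the identity on its
  orthogonal complement. The defect in the inner product is a multiple of
  \<open>c\<^sup>2 + s\<^sup>2 - 1\<close>.\<close>

lemma plane_rotation_orthogonal_transformation:
  fixes x y :: "'a::euclidean_space"
  assumes "x \<bullet> x = 1" "y \<bullet> y = 1" "x \<bullet> y = 0" "c\<^sup>2 + s\<^sup>2 = 1"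
  shows "orthogonal_transformation (\<lambda>z. z + (c - 1) *\<^sub>R ((z \<bullet> x) *\<^sub>R x + (z \<bullet> y) *\<^sub>R y)
           + s *\<^sub>R ((z \<bullet> x) *\<^sub>R y - (z \<bullet> y) *\<^sub>R x))" (is "orthogonal_transformation ?O")
proof -
  have "y \<bullet> x = 0" using assms by (simp add: inner_commute)
  have "linear ?O"
    by (rule linearI) (simp_all add: inner_add_left algebra_simps)
  moreover have "?O v \<bullet> ?O w = v \<bullet> w" for v w
  proof -
    have gen: "(v + (A *\<^sub>R x + B *\<^sub>R y)) \<bullet> (w + (A' *\<^sub>R x + B' *\<^sub>R y))
        = v \<bullet> w + A' * (v \<bullet> x) + B' * (v \<bullet> y) + A * (w \<bullet> x) + B * (w \<bullet> y) + A * A' + B * B'"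
      for A B A' B'
      using assms \<open>y \<bullet> x = 0\<close>
      by (simp add: inner_add_left inner_add_right inner_commute[of x w] inner_commute[of y w])
        (simp add: distrib_left)
    have O: "?O z = z + (((c - 1) * (z \<bullet> x) - s * (z \<bullet> y)) *\<^sub>R x
        + ((c - 1) * (z \<bullet> y) + s * (z \<bullet> x)) *\<^sub>R y)" for z
      by (simp add: algebra_simps)
    have "?O v \<bullet> ?O w - v \<bullet> w
        = (c\<^sup>2 + s\<^sup>2 - 1) * ((v \<bullet> x) * (w \<bullet> x) + (v \<bullet> y) * (w \<bullet> y))"
      unfolding O gen by (simp add: power2_eq_square algebra_simps)
    then show ?thesis using assms by simp
  qed
  ultimately show ?thesis by (simp add: orthogonal_transformation_def)
qed

text \<open>This is the first-order condition at a minimum over the orthogonal group. Orthogonal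
  maps preserve norms, so minimizing the squared distances means maximizing the sum of the
  \<open>T (q i) \<bullet> Q i\<close>. Its derivative along rotations in the plane of an
  orthonormal pair \<open>x\<close>, \<open>y\<close> is the antisymmetric moment
  \<open>C x y\<close>, which therefore vanishes; bilinearity extends this to all \<open>x\<close>
  and \<open>y\<close>.\<close>

lemma best_alignment_symmetric_moment:
  fixes q Q :: "'v \<Rightarrow> 'a::euclidean_space"
  assumes best: "\<And>T. orthogonal_transformation T \<Longrightarrow>
      (\<Sum>i\<in>V. (norm (q i - Q i))\<^sup>2) \<le> (\<Sum>i\<in>V. (norm (T (q i) - Q i))\<^sup>2)"
  shows "(\<Sum>i\<in>V. (q i \<bullet> x) * (Q i \<bullet> y)) = (\<Sum>i\<in>V. (q i \<bullet> y) * (Q i \<bullet> x))"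
proof -
  define C where "C x y = (\<Sum>i\<in>V. (q i \<bullet> x) * (Q i \<bullet> y) - (q i \<bullet> y) * (Q i \<bullet> x))" for x y
  have best': "(\<Sum>i\<in>V. T (q i) \<bullet> Q i) \<le> (\<Sum>i\<in>V. q i \<bullet> Q i)" if T: "orthogonal_transformation T" for T
  proof -
    have "(norm (T z - w))\<^sup>2 = (norm z)\<^sup>2 + (norm w)\<^sup>2 - 2 * (T z \<bullet> w)" for z w
      using T by (simp add: power2_norm_eq_inner orthogonal_transformation_def algebra_simps inner_commute)
    moreover have "(norm (z - w))\<^sup>2 = (norm z)\<^sup>2 + (norm w)\<^sup>2 - 2 * (z \<bullet> w)" for z w :: 'a
      by (simp add: power2_norm_eq_inner algebra_simps inner_commute)
    ultimately show ?thesis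
      using best[OF T] by (simp add: sum.distrib sum_subtractf sum_distrib_left[symmetric])
  qed
  have ortho: "C x y = 0" if xy: "x \<bullet> x = 1" "y \<bullet> y = 1" "x \<bullet> y = 0" for x y
  proof -
    \<comment> \<open>The rotation changes the objective by exactly
      \<open>(c - 1) * B + s * C x y\<close>.\<close>
    define B where "B = (\<Sum>i\<in>V. (q i \<bullet> x) * (Q i \<bullet> x) + (q i \<bullet> y) * (Q i \<bullet> y))"
    have cs: "(c - 1) * B + s * C x y \<le> 0" if "c\<^sup>2 + s\<^sup>2 = 1" for c s
    proof -
      let ?O = "\<lambda>z. z + (c - 1) *\<^sub>R ((z \<bullet> x) *\<^sub>R x + (z \<bullet> y) *\<^sub>R y)
           + s *\<^sub>R ((z \<bullet> x) *\<^sub>R y - (z \<bullet> y) *\<^sub>R x)"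
      have "(\<Sum>i\<in>V. ?O (q i) \<bullet> Q i) = (\<Sum>i\<in>V. q i \<bullet> Q i) + ((c - 1) * B + s * C x y)"
        unfolding B_def C_def sum_distrib_left sum.distrib[symmetric]
        by (intro sum.cong refl)
          (simp add: inner_add_left inner_diff_left inner_commute algebra_simps)
      then show ?thesis
        using best'[OF plane_rotation_orthogonal_transformation[OF xy that]] by linarith
    qed
    \<comment> \<open>rational parametrisation of the unit circle\<close>
    have t: "t * C x y \<le> t\<^sup>2 * B" for t
    proof -
      define D where "D = 1 + t\<^sup>2"
      have D: "D > 0" by (simp add: D_def add_pos_nonneg)
      have "((1 - t\<^sup>2) / D)\<^sup>2 + (2 * t / D)\<^sup>2 = ((1 - t\<^sup>2)\<^sup>2 + (2 * t)\<^sup>2) / D\<^sup>2"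
        by (simp add: power_divide add_divide_distrib)
      also have "(1 - t\<^sup>2)\<^sup>2 + (2 * t)\<^sup>2 = D\<^sup>2" by (simp add: D_def power2_eq_square algebra_simps)
      finally have "((1 - t\<^sup>2) / D)\<^sup>2 + (2 * t / D)\<^sup>2 = 1" using D by simp
      from cs[OF this] have "D * (((1 - t\<^sup>2) / D - 1) * B + (2 * t / D) * C x y) \<le> 0"
        using D by (simp add: mult_le_0_iff)
      also have "D * (((1 - t\<^sup>2) / D - 1) * B + (2 * t / D) * C x y)
          = ((1 - t\<^sup>2) - D) * B + 2 * t * C x y" using D by (simp add: field_simps)
      finally show ?thesis by (simp add: D_def)
    qed
    show ?thesis
    proof (rule ccontr)
      assume nz: "C x y \<noteq> 0"
      \<comment> \<open>\<open>K\<close> is positive and exceeds \<open>B\<close>; at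
        \<open>t = C x y / K\<close> the linear term of \<open>t\<close> then dominates the
        quadratic one.\<close>
      define K where "K = \<bar>B\<bar> + 1"
      have "C x y / K * C x y \<le> (C x y / K)\<^sup>2 * B" by (rule t)
      also have "\<dots> \<le> (C x y / K)\<^sup>2 * \<bar>B\<bar>" by (intro mult_left_mono) auto
      also have "\<dots> < (C x y / K)\<^sup>2 * K" using nz by (intro mult_strict_left_mono) (auto simp: K_def)
      also have "\<dots> = C x y / K * C x y" by (simp add: power2_eq_square K_def)
      finally show False by simp
    qed
  qed
  have self: "C x x = 0" for x by (simp add: C_def mult.commute)
  have scale: "C (a *\<^sub>R x) (b *\<^sub>R y) = a * b * C x y" for a b x y
    unfolding C_def sum_distrib_left by (intro sum.cong refl) (simp add: algebra_simps)
  have diff: "C x (y - z) = C x y - C x z" for x y z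
    unfolding C_def sum_subtractf[symmetric] by (intro sum.cong refl) (simp add: algebra_simps inner_diff_right)
  have "C x y = 0"
  proof (cases "x = 0")
    case True
    then show ?thesis by (simp add: C_def)
  next
    case x: False
    \<comment> \<open>A Gram-Schmidt step; as \<open>C\<close> is alternating, removing the
      component along \<open>x\<close> leaves \<open>C x y\<close> unchanged.\<close>
    define y' where "y' = y - ((x \<bullet> y) / (x \<bullet> x)) *\<^sub>R x"
    have "C x y' = C x y" using scale[of 1 x "(x \<bullet> y) / (x \<bullet> x)" x] by (simp add: y'_def diff self)
    moreover have "C x y' = 0"
    proof (cases "y' = 0")
      case True
      then show ?thesis by (simp add: C_def)
    next
      case y: False
      have "x \<bullet> y' = 0" using x by (simp add: y'_def inner_diff_right)
      then have "C ((1 / norm x) *\<^sub>R x) ((1 / norm y') *\<^sub>R y') = 0"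
        using x y by (intro ortho) (simp_all add: dot_square_norm power2_eq_square)
      then show ?thesis using x y by (simp add: scale)
    qed
    ultimately show ?thesis by simp
  qed
  then show ?thesis by (simp add: C_def sum_subtractf)
qed

text \<open>A minimizing sequence has a convergent subsequence, and the objective is continuous
  under pointwise convergence.\<close>

lemma exists_best_alignment:
  fixes q Q :: "'v \<Rightarrow> 'a::euclidean_space"
  shows "\<exists>R. orthogonal_transformation R \<and> (\<forall>T. orthogonal_transformation T \<longrightarrow>
      (\<Sum>i\<in>V. (norm (R (q i) - Q i))\<^sup>2) \<le> (\<Sum>i\<in>V. (norm (T (q i) - Q i))\<^sup>2))"
proof -
  define E where "E R = (\<Sum>i\<in>V. (norm (R (q i) - Q i))\<^sup>2)" for R :: "'a \<Rightarrow> 'a"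
  define S where "S = E ` {R. orthogonal_transformation R}"
  have "E R \<ge> 0" for R by (simp add: E_def sum_nonneg)
  then have bdd: "bdd_below S" unfolding S_def bdd_below_def by auto
  have ne: "S \<noteq> {}" using orthogonal_transformation_id unfolding S_def by blast
  have "\<exists>R. orthogonal_transformation R \<and> E R < Inf S + inverse (real (Suc n))" for n
    using cInf_lessD[OF ne, of "Inf S + inverse (real (Suc n))"] by (auto simp: S_def)
  then obtain R where R: "\<And>n. orthogonal_transformation (R n)"
    and E: "\<And>n. E (R n) < Inf S + inverse (real (Suc n))" by metis
  obtain T r where r: "strict_mono (r :: nat \<Rightarrow> nat)" and T: "orthogonal_transformation T"
    and lim: "\<And>x. (\<lambda>n. R (r n) x) \<longlonglongrightarrow> T x"
    using orthogonal_transformation_convergent_subsequence[of R] R by blast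
  have "(\<lambda>n. E (R (r n))) \<longlonglongrightarrow> E T" unfolding E_def by (intro tendsto_intros lim)
  moreover have "(\<lambda>n. Inf S + inverse (real (Suc (r n)))) \<longlonglongrightarrow> Inf S"
    using LIMSEQ_subseq_LIMSEQ[OF LIMSEQ_inverse_real_of_nat_add[of "Inf S"] r] by (simp add: o_def)
  ultimately have "E T \<le> Inf S"
    using E by (intro LIMSEQ_le) (auto intro: less_imp_le)
  moreover have "Inf S \<le> E O'" if "orthogonal_transformation O'" for O'
    using that by (intro cInf_lower bdd) (auto simp: S_def)
  ultimately show ?thesis using T unfolding E_def by (meson order_trans)
qed

section \<open>Blow-up of converging realizations to a second-order motion\<close>

text \<open>Here \<open>\<delta>\<close> and \<open>\<beta>\<close> are displacements of vertices
  and facet normals. Rescaled to total norm 1 they converge along a subsequence to a first-order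
  motion; the quadratic remainders show that the right-hand side of the second-order system is a
  limit of values of the linearized constraints, hence a value. The limit relation for
  \<open>p'\<close> is kept in the conclusion so that linear conditions on \<open>\<delta>\<close>
  pass on to \<open>p'\<close>.\<close>

lemma second_order_blow_up:
  fixes p :: "'v \<Rightarrow> 'a::euclidean_space" and a :: "'f \<Rightarrow> 'a"
    and \<delta> :: "nat \<Rightarrow> 'v \<Rightarrow> 'a" and \<beta> :: "nat \<Rightarrow> 'f \<Rightarrow> 'a"
  assumes V: "finite V" and F: "finite F"
    and E: "E \<subseteq> V \<times> V" and I: "I \<subseteq> V \<times> F"
    and edge: "\<And>n i j. (i, j) \<in> E \<Longrightarrow>
      2 * ((p i - p j) \<bullet> (\<delta> n i - \<delta> n j)) + (\<delta> n i - \<delta> n j) \<bullet> (\<delta> n i - \<delta> n j) = 0"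
    and inc: "\<And>n i \<sigma>. (i, \<sigma>) \<in> I \<Longrightarrow> p i \<bullet> \<beta> n \<sigma> + \<delta> n i \<bullet> a \<sigma> + \<delta> n i \<bullet> \<beta> n \<sigma> = 0"
    and lim\<delta>: "\<And>i. i \<in> V \<Longrightarrow> (\<lambda>n. \<delta> n i) \<longlonglongrightarrow> 0"
    and lim\<beta>: "\<And>\<sigma>. \<sigma> \<in> F \<Longrightarrow> (\<lambda>n. \<beta> n \<sigma>) \<longlonglongrightarrow> 0"
    and nz: "\<And>n. \<exists>i\<in>V. \<delta> n i \<noteq> 0"
  shows "\<exists>r s p' a' p'' a''.
      (\<forall>i\<in>V. (\<lambda>n. \<delta> (r n) i /\<^sub>R s n) \<longlonglongrightarrow> p' i) \<and>
      (\<forall>(i, j)\<in>E. (p i - p j) \<bullet> (p' i - p' j) = 0) \<and>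
      (\<forall>(i, \<sigma>)\<in>I. p i \<bullet> a' \<sigma> + p' i \<bullet> a \<sigma> = 0) \<and>
      (\<forall>(i, j)\<in>E. (p i - p j) \<bullet> (p'' i - p'' j) + (p' i - p' j) \<bullet> (p' i - p' j) = 0) \<and>
      (\<forall>(i, \<sigma>)\<in>I. p i \<bullet> a'' \<sigma> + 2 * (p' i \<bullet> a' \<sigma>) + p'' i \<bullet> a \<sigma> = 0) \<and>
      ((\<exists>i\<in>V. p' i \<noteq> 0) \<or> (\<exists>\<sigma>\<in>F. a' \<sigma> \<noteq> 0))"
proof -
  \<comment> \<open>Both kinds of displacement enter the scale, since neither is known to be bounded
    by the other. The limit is thus nonzero only as a pair.\<close>
  define S where "S n = (\<Sum>i\<in>V. norm (\<delta> n i)) + (\<Sum>\<sigma>\<in>F. norm (\<beta> n \<sigma>))" for n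
  have S_pos: "S n > 0" for n
  proof -
    obtain i where i: "i \<in> V" "\<delta> n i \<noteq> 0" using nz by blast
    have "0 < (\<Sum>i\<in>V. norm (\<delta> n i))" using i by (intro sum_pos2[OF V i(1)]) auto
    then show ?thesis by (simp add: S_def add_pos_nonneg sum_nonneg)
  qed
  have S_lim: "S \<longlonglongrightarrow> 0"
  proof -
    have "S \<longlonglongrightarrow> (\<Sum>i\<in>V. norm (0 :: 'a)) + (\<Sum>\<sigma>\<in>F. norm (0 :: 'a))"
      unfolding S_def by (intro tendsto_intros lim\<delta> lim\<beta>)
    then show ?thesis by simp
  qed
  define \<pi> where "\<pi> n i = \<delta> n i /\<^sub>R S n" for n i
  define \<alpha> where "\<alpha> n \<sigma> = \<beta> n \<sigma> /\<^sub>R S n" for n \<sigma>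
  have \<delta>: "\<delta> n i = S n *\<^sub>R \<pi> n i" for n i using S_pos[of n] by (simp add: \<pi>_def)
  have \<beta>: "\<beta> n \<sigma> = S n *\<^sub>R \<alpha> n \<sigma>" for n \<sigma> using S_pos[of n] by (simp add: \<alpha>_def)
  have edge': "(p i - p j) \<bullet> (\<pi> n i - \<pi> n j) = - (S n / 2) * ((\<pi> n i - \<pi> n j) \<bullet> (\<pi> n i - \<pi> n j))"
    if "(i, j) \<in> E" for n i j
  proof -
    have "S n * (2 * ((p i - p j) \<bullet> (\<pi> n i - \<pi> n j)) + S n * ((\<pi> n i - \<pi> n j) \<bullet> (\<pi> n i - \<pi> n j))) = 0"
      using edge[OF that, of n] unfolding \<delta> scaleR_diff_right[symmetric]
      by (simp add: algebra_simps)
    then have "2 * ((p i - p j) \<bullet> (\<pi> n i - \<pi> n j)) + S n * ((\<pi> n i - \<pi> n j) \<bullet> (\<pi> n i - \<pi> n j)) = 0"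
      using S_pos[of n] by (simp only: mult_eq_0_iff) simp
    then show ?thesis by linarith
  qed
  have inc': "p i \<bullet> \<alpha> n \<sigma> + \<pi> n i \<bullet> a \<sigma> = - S n * (\<pi> n i \<bullet> \<alpha> n \<sigma>)" if "(i, \<sigma>) \<in> I" for n i \<sigma>
  proof -
    have "S n * (p i \<bullet> \<alpha> n \<sigma> + \<pi> n i \<bullet> a \<sigma> + S n * (\<pi> n i \<bullet> \<alpha> n \<sigma>)) = 0"
      using inc[OF that, of n] unfolding \<delta> \<beta> by (simp add: algebra_simps)
    then have "p i \<bullet> \<alpha> n \<sigma> + \<pi> n i \<bullet> a \<sigma> + S n * (\<pi> n i \<bullet> \<alpha> n \<sigma>) = 0"
      using S_pos[of n] by (simp only: mult_eq_0_iff) simp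
    then show ?thesis by linarith
  qed
  have norm1: "(\<Sum>i\<in>V. norm (\<pi> n i)) + (\<Sum>\<sigma>\<in>F. norm (\<alpha> n \<sigma>)) = 1" for n
  proof -
    have "(\<Sum>i\<in>V. norm (\<pi> n i)) + (\<Sum>\<sigma>\<in>F. norm (\<alpha> n \<sigma>)) = inverse (S n) * S n"
      using S_pos[of n]
      by (simp add: \<pi>_def \<alpha>_def S_def[of n, symmetric] sum_distrib_left[symmetric] distrib_left[symmetric])
    then show ?thesis using S_pos[of n] by simp
  qed
  have "norm (\<pi> n i) \<le> 1" if "i \<in> V" for n i
    using norm1[of n] member_le_sum[OF that, of "\<lambda>i. norm (\<pi> n i)"] V
      sum_nonneg[of F "\<lambda>\<sigma>. norm (\<alpha> n \<sigma>)"] by simp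
  moreover have "norm (\<alpha> n \<sigma>) \<le> 1" if "\<sigma> \<in> F" for n \<sigma>
    using norm1[of n] member_le_sum[OF that, of "\<lambda>i. norm (\<alpha> n i)"] F
      sum_nonneg[of V "\<lambda>i. norm (\<pi> n i)"] by simp
  ultimately have "bounded (range (\<lambda>n. case_sum (\<pi> n) (\<alpha> n) x))" if "x \<in> V <+> F" for x
    unfolding bounded_iff using that by (intro exI[of _ 1]) auto
  then obtain l r where r: "strict_mono (r :: nat \<Rightarrow> nat)"
    and l: "\<And>x. x \<in> V <+> F \<Longrightarrow> (\<lambda>n. case_sum (\<pi> (r n)) (\<alpha> (r n)) x) \<longlonglongrightarrow> l x"
    using finite_family_convergent_subsequence[of "V <+> F" "\<lambda>n. case_sum (\<pi> n) (\<alpha> n)"] V F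
    by auto
  define p' where "p' i = l (Inl i)" for i
  define a' where "a' \<sigma> = l (Inr \<sigma>)" for \<sigma>
  have p': "(\<lambda>n. \<pi> (r n) i) \<longlonglongrightarrow> p' i" if "i \<in> V" for i
    using l[of "Inl i"] that by (simp add: p'_def InlI)
  have a': "(\<lambda>n. \<alpha> (r n) \<sigma>) \<longlonglongrightarrow> a' \<sigma>" if "\<sigma> \<in> F" for \<sigma>
    using l[of "Inr \<sigma>"] that by (simp add: a'_def InrI)
  have Sr: "(\<lambda>n. S (r n)) \<longlonglongrightarrow> 0"
    using LIMSEQ_subseq_LIMSEQ[OF S_lim r] by (simp add: o_def)
  have first_edge: "(p i - p j) \<bullet> (p' i - p' j) = 0" if ij: "(i, j) \<in> E" for i j
  proof (rule LIMSEQ_unique)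
    have V': "i \<in> V" "j \<in> V" using E ij by auto
    show "(\<lambda>n. (p i - p j) \<bullet> (\<pi> (r n) i - \<pi> (r n) j)) \<longlonglongrightarrow> (p i - p j) \<bullet> (p' i - p' j)"
      by (intro tendsto_intros p' V')
    have "(\<lambda>n. - (S (r n) / 2) * ((\<pi> (r n) i - \<pi> (r n) j) \<bullet> (\<pi> (r n) i - \<pi> (r n) j)))
        \<longlonglongrightarrow> - (0 / 2) * ((p' i - p' j) \<bullet> (p' i - p' j))"
      by (intro tendsto_intros p' V' Sr) simp
    then show "(\<lambda>n. (p i - p j) \<bullet> (\<pi> (r n) i - \<pi> (r n) j)) \<longlonglongrightarrow> 0"
      using edge'[OF ij] by simp
  qed
  have first_inc: "p i \<bullet> a' \<sigma> + p' i \<bullet> a \<sigma> = 0" if i\<sigma>: "(i, \<sigma>) \<in> I" for i \<sigma>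
  proof (rule LIMSEQ_unique)
    have VF: "i \<in> V" "\<sigma> \<in> F" using I i\<sigma> by auto
    show "(\<lambda>n. p i \<bullet> \<alpha> (r n) \<sigma> + \<pi> (r n) i \<bullet> a \<sigma>) \<longlonglongrightarrow> p i \<bullet> a' \<sigma> + p' i \<bullet> a \<sigma>"
      by (intro tendsto_intros p' a' VF)
    have "(\<lambda>n. - S (r n) * (\<pi> (r n) i \<bullet> \<alpha> (r n) \<sigma>)) \<longlonglongrightarrow> - 0 * (p' i \<bullet> a' \<sigma>)"
      by (intro tendsto_intros p' a' VF Sr)
    then show "(\<lambda>n. p i \<bullet> \<alpha> (r n) \<sigma> + \<pi> (r n) i \<bullet> a \<sigma>) \<longlonglongrightarrow> 0"
      using inc'[OF i\<sigma>] by simp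
  qed
  \<comment> \<open>\<open>w x y\<close> is the coefficient of the unknown \<open>x\<close> (a
    vertex or a normal) in the linearized constraint \<open>y\<close> (an edge or an incidence). The
    difference of two conditionals also covers \<open>i = j\<close>.\<close>
  define w :: "'v + 'f \<Rightarrow> ('v \<times> 'v) + ('v \<times> 'f) \<Rightarrow> 'a" where
    "w x y = (case y of
        Inl (i, j) \<Rightarrow> (case x of Inl k \<Rightarrow> (if k = i then p i - p j else 0) - (if k = j then p i - p j else 0)
                             | Inr \<tau> \<Rightarrow> 0)
      | Inr (i, \<sigma>) \<Rightarrow> (case x of Inl k \<Rightarrow> (if k = i then a \<sigma> else 0)
                             | Inr \<tau> \<Rightarrow> (if \<tau> = \<sigma> then p i else 0)))" for x y
  have w_edge: "(\<Sum>x\<in>V <+> F. w x (Inl (i, j)) \<bullet> z x) = (p i - p j) \<bullet> (z (Inl i) - z (Inl j))"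
    if "(i, j) \<in> E" for i j z
  proof -
    have "i \<in> V" "j \<in> V" using E that by auto
    then show ?thesis using V F
      by (simp add: sum.Plus w_def inner_diff_left sum_subtractf if_distrib[of "\<lambda>u. u \<bullet> _"] cong: if_cong)
        (simp add: inner_diff_right inner_diff_left)
  qed
  have w_inc: "(\<Sum>x\<in>V <+> F. w x (Inr (i, \<sigma>)) \<bullet> z x) = a \<sigma> \<bullet> z (Inl i) + p i \<bullet> z (Inr \<sigma>)"
    if "(i, \<sigma>) \<in> I" for i \<sigma> z
  proof -
    have "i \<in> V" "\<sigma> \<in> F" using I that by auto
    then show ?thesis using V F
      by (simp add: sum.Plus w_def if_distrib[of "\<lambda>u. u \<bullet> _"] cong: if_cong)
  qed
  \<comment> \<open>By \<open>edge'\<close> and \<open>inc'\<close>, the factor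
    \<open>2 / S (r n)\<close> makes the linearized constraints at \<open>x n\<close> equal to the
    quadratic terms whose limit is \<open>y\<close>.\<close>
  define x where "x n = (\<lambda>y. (2 / S (r n)) *\<^sub>R case_sum (\<pi> (r n)) (\<alpha> (r n)) y)" for n
  define y where "y = case_sum (\<lambda>(i, j). - ((p' i - p' j) \<bullet> (p' i - p' j)))
      (\<lambda>(i, \<sigma>). - 2 * (p' i \<bullet> a' \<sigma>))"
  have "(\<lambda>n. \<Sum>x'\<in>V <+> F. w x' k \<bullet> x n x') \<longlonglongrightarrow> y k" if k: "k \<in> E <+> I" for k
    using k
  proof (elim PlusE)
    fix e assume "e \<in> E" and k: "k = Inl e"
    then obtain i j where e: "e = (i, j)" "(i, j) \<in> E" by (cases e) auto
    then have V': "i \<in> V" "j \<in> V" using E by auto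
    have "(\<Sum>x'\<in>V <+> F. w x' k \<bullet> x n x') = - ((\<pi> (r n) i - \<pi> (r n) j) \<bullet> (\<pi> (r n) i - \<pi> (r n) j))" for n
    proof -
      have "(\<Sum>x'\<in>V <+> F. w x' k \<bullet> x n x') = (2 / S (r n)) * ((p i - p j) \<bullet> (\<pi> (r n) i - \<pi> (r n) j))"
        unfolding k e(1) w_edge[OF e(2)] by (simp add: x_def scaleR_diff_right[symmetric])
      then show ?thesis using S_pos[of "r n"] by (simp add: edge'[OF e(2)])
    qed
    then show "(\<lambda>n. \<Sum>x'\<in>V <+> F. w x' k \<bullet> x n x') \<longlonglongrightarrow> y k"
      by (simp add: y_def k e(1)) (intro tendsto_intros p' V')
  next
    fix e assume "e \<in> I" and k: "k = Inr e"
    then obtain i \<sigma> where e: "e = (i, \<sigma>)" "(i, \<sigma>) \<in> I" by (cases e) auto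
    then have VF: "i \<in> V" "\<sigma> \<in> F" using I by auto
    have "(\<Sum>x'\<in>V <+> F. w x' k \<bullet> x n x') = - 2 * (\<pi> (r n) i \<bullet> \<alpha> (r n) \<sigma>)" for n
    proof -
      have "(\<Sum>x'\<in>V <+> F. w x' k \<bullet> x n x') = (2 / S (r n)) * (p i \<bullet> \<alpha> (r n) \<sigma> + \<pi> (r n) i \<bullet> a \<sigma>)"
        unfolding k e(1) w_inc[OF e(2)] by (simp add: x_def inner_commute[of "a \<sigma>"] distrib_left)
      then show ?thesis using S_pos[of "r n"] by (simp add: inc'[OF e(2)])
    qed
    then show "(\<lambda>n. \<Sum>x'\<in>V <+> F. w x' k \<bullet> x n x') \<longlonglongrightarrow> y k"
      by (simp add: y_def k e(1)) (intro tendsto_intros p' a' VF)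
  qed
  moreover have "finite (E <+> I)"
    using V F E I by (auto intro: finite_subset)
  ultimately obtain z where z: "\<And>k. k \<in> E <+> I \<Longrightarrow> y k = (\<Sum>x\<in>V <+> F. w x k \<bullet> z x)"
    using closed_linear_image_pointwise[of "V <+> F" "E <+> I" w x y] V F by auto
  define p'' where "p'' i = z (Inl i)" for i
  define a'' where "a'' \<sigma> = z (Inr \<sigma>)" for \<sigma>
  have second_edge: "(p i - p j) \<bullet> (p'' i - p'' j) + (p' i - p' j) \<bullet> (p' i - p' j) = 0"
    if "(i, j) \<in> E" for i j
    using z[of "Inl (i, j)"] that unfolding w_edge[OF that] by (simp add: y_def p''_def InlI)
  have second_inc: "p i \<bullet> a'' \<sigma> + 2 * (p' i \<bullet> a' \<sigma>) + p'' i \<bullet> a \<sigma> = 0" if "(i, \<sigma>) \<in> I" for i \<sigma>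
    using z[of "Inr (i, \<sigma>)"] that unfolding w_inc[OF that]
    by (simp add: y_def p''_def a''_def InrI inner_commute[of "a \<sigma>"])
  have "(\<Sum>i\<in>V. norm (p' i)) + (\<Sum>\<sigma>\<in>F. norm (a' \<sigma>)) = 1"
  proof (rule LIMSEQ_unique)
    show "(\<lambda>n. (\<Sum>i\<in>V. norm (\<pi> (r n) i)) + (\<Sum>\<sigma>\<in>F. norm (\<alpha> (r n) \<sigma>)))
        \<longlonglongrightarrow> (\<Sum>i\<in>V. norm (p' i)) + (\<Sum>\<sigma>\<in>F. norm (a' \<sigma>))"
      by (intro tendsto_intros p' a')
    show "(\<lambda>n. (\<Sum>i\<in>V. norm (\<pi> (r n) i)) + (\<Sum>\<sigma>\<in>F. norm (\<alpha> (r n) \<sigma>))) \<longlonglongrightarrow> 1"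
      by (simp add: norm1)
  qed
  then have nontriv: "(\<exists>i\<in>V. p' i \<noteq> 0) \<or> (\<exists>\<sigma>\<in>F. a' \<sigma> \<noteq> 0)"
    by (rule contrapos_pp) simp
  show ?thesis
    using p' first_edge first_inc second_edge second_inc nontriv unfolding \<pi>_def
    by (intro exI[of _ r] exI[of _ "\<lambda>n. S (r n)"] exI[of _ p'] exI[of _ a'] exI[of _ p''] exI[of _ a''])
      auto
qed

section \<open>Realizations close to an isometric copy\<close>

text \<open>Measuring from the centroid removes translations, so that isometric copies are compared
  by orthogonal maps alone.\<close>

definition centered :: "'v set \<Rightarrow> ('v \<Rightarrow> 'a::real_vector) \<Rightarrow> 'v \<Rightarrow> 'a" where
  "centered V p i = p i - (1 / real (card V)) *\<^sub>R (\<Sum>j\<in>V. p j)"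

lemma sum_centered:
  assumes "finite V" "V \<noteq> {}"
  shows "(\<Sum>i\<in>V. centered V p i) = 0"
  using assms by (simp add: centered_def sum_subtractf scaleR_right.sum[symmetric] sum_constant_scaleR)

lemma centered_diff: "centered V p i - centered V p j = p i - p j"
  by (simp add: centered_def)

lemma tendsto_centered:
  fixes p :: "'n \<Rightarrow> 'v \<Rightarrow> 'a::real_normed_vector"
  assumes "\<And>i. i \<in> V \<Longrightarrow> ((\<lambda>n. p n i) \<longlongrightarrow> q i) G" "i \<in> V"
  shows "((\<lambda>n. centered V (p n) i) \<longlongrightarrow> centered V q i) G"
  unfolding centered_def by (intro tendsto_intros assms)

text \<open>If every \<open>p n\<close> failed to be isometric to \<open>p0\<close>, the aligned
  displacements would be nonzero and tend to zero, and their blow-up would be a nonzero second-order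
  motion. Rigidity makes it trivial and the alignment makes it vanish. One isometric term is enough,
  since the lemma is meant for sequences assumed to have none.\<close>

lemma second_order_rigid_isometric_nearby:
  fixes p :: "nat \<Rightarrow> 'v \<Rightarrow> 'a::euclidean_space" and a :: "nat \<Rightarrow> 'f \<Rightarrow> 'a"
    and p0 q :: "'v \<Rightarrow> 'a" and a0 b :: "'f \<Rightarrow> 'a"
  assumes V: "finite (verts K)" "verts K \<noteq> {}" and F: "finite (facets K)"
    and edges: "\<And>i j. {i, j} \<in> edges K \<Longrightarrow> i \<in> verts K \<and> j \<in> verts K"
    and spanV: "\<And>z. (\<And>i. i \<in> verts K \<Longrightarrow> z \<bullet> centered (verts K) p0 i = 0) \<Longrightarrow> z = 0"
    and spanF: "\<And>\<sigma> z. \<sigma> \<in> facets K \<Longrightarrow>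
      (\<And>i. i \<in> verts K \<Longrightarrow> incident K i \<sigma> \<Longrightarrow> z \<bullet> p0 i = 0) \<Longrightarrow> z = 0"
    and rigid: "second_order_rigid K (p0, a0)"
    and inc0: "\<And>i \<sigma>. i \<in> verts K \<Longrightarrow> \<sigma> \<in> facets K \<Longrightarrow> incident K i \<sigma> \<Longrightarrow> p0 i \<bullet> a0 \<sigma> = 1"
    and inc: "\<And>n i \<sigma>. i \<in> verts K \<Longrightarrow> \<sigma> \<in> facets K \<Longrightarrow> incident K i \<sigma> \<Longrightarrow> p n i \<bullet> a n \<sigma> = 1"
    and len: "\<And>n i j. {i, j} \<in> edges K \<Longrightarrow> norm (p n i - p n j) = norm (p0 i - p0 j)"
    and limp: "\<And>i. i \<in> verts K \<Longrightarrow> (\<lambda>n. p n i) \<longlonglongrightarrow> q i"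
    and lima: "\<And>\<sigma>. \<sigma> \<in> facets K \<Longrightarrow> (\<lambda>n. a n \<sigma>) \<longlonglongrightarrow> b \<sigma>"
    and U: "orthogonal_transformation U"
      "\<And>i. i \<in> verts K \<Longrightarrow> U (centered (verts K) q i) = centered (verts K) p0 i"
  shows "\<exists>n R. orthogonal_transformation R \<and>
    (\<forall>i\<in>verts K. R (centered (verts K) (p n) i) = centered (verts K) p0 i)"
proof (rule ccontr)
  let ?V = "verts K" and ?F = "facets K"
  let ?c = "centered (verts K)"
  assume contr: "\<not> ?thesis"
  define m where "m p = (1 / real (card ?V)) *\<^sub>R (\<Sum>j\<in>?V. p j)" for p :: "'v \<Rightarrow> 'a"
  have c: "?c p i = p i - m p" for p :: "'v \<Rightarrow> 'a" and i by (simp add: centered_def m_def)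
  have limc: "(\<lambda>n. ?c (p n) i) \<longlonglongrightarrow> ?c q i" if "i \<in> ?V" for i
    by (intro tendsto_centered limp that)
  have limm: "(\<lambda>n. m (p n)) \<longlonglongrightarrow> m q" unfolding m_def by (intro tendsto_intros limp)
  have inc_lim: "q i \<bullet> b \<sigma> = 1" if "i \<in> ?V" "\<sigma> \<in> ?F" "incident K i \<sigma>" for i \<sigma>
  proof (rule LIMSEQ_unique)
    show "(\<lambda>n. p n i \<bullet> a n \<sigma>) \<longlonglongrightarrow> q i \<bullet> b \<sigma>" by (intro tendsto_intros limp lima that)
    show "(\<lambda>n. p n i \<bullet> a n \<sigma>) \<longlonglongrightarrow> 1" using inc[OF that] by simp
  qed
  have "\<forall>n. \<exists>R. orthogonal_transformation R \<and> (\<forall>T. orthogonal_transformation T \<longrightarrow>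
      (\<Sum>i\<in>?V. (norm (R (?c (p n) i) - ?c p0 i))\<^sup>2) \<le> (\<Sum>i\<in>?V. (norm (T (?c (p n) i) - ?c p0 i))\<^sup>2))"
    by (intro allI exists_best_alignment)
  from choice[OF this] obtain R where R: "\<And>n. orthogonal_transformation (R n)"
    and best: "\<And>n T. orthogonal_transformation T \<Longrightarrow>
      (\<Sum>i\<in>?V. (norm (R n (?c (p n) i) - ?c p0 i))\<^sup>2) \<le> (\<Sum>i\<in>?V. (norm (T (?c (p n) i) - ?c p0 i))\<^sup>2)"
    by blast
  have linR: "linear (R n)" for n using R orthogonal_transformation_linear by blast
  have normR: "norm (R n x) = norm x" for n x using R orthogonal_transformation_norm by blast
  have innR: "R n x \<bullet> R n y = x \<bullet> y" for n x y using R by (simp add: orthogonal_transformation_def)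
  define e where "e n i = R n (?c (p n) i) - ?c p0 i" for n i
  \<comment> \<open>The optimal alignment is at least as good as the fixed map \<open>U\<close>,
    whose error tends to zero.\<close>
  have e_lim: "(\<lambda>n. e n i) \<longlonglongrightarrow> 0" if i: "i \<in> ?V" for i
  proof -
    have U_cont: "(\<lambda>n. U (x n)) \<longlonglongrightarrow> U l" if "x \<longlonglongrightarrow> l" for x l
      by (rule bounded_linear.tendsto[OF _ that])
        (use U(1) in \<open>simp add: linear_conv_bounded_linear[symmetric] orthogonal_transformation_linear\<close>)
    have "(\<lambda>n. \<Sum>i\<in>?V. (norm (U (?c (p n) i) - ?c p0 i))\<^sup>2)
        \<longlonglongrightarrow> (\<Sum>i\<in>?V. (norm (U (?c q i) - ?c p0 i))\<^sup>2)"
      by (intro tendsto_intros U_cont limc)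
    then have to0: "(\<lambda>n. \<Sum>i\<in>?V. (norm (U (?c (p n) i) - ?c p0 i))\<^sup>2) \<longlonglongrightarrow> 0"
      using U(2) by simp
    have bound: "norm ((norm (e n i))\<^sup>2) \<le> (\<Sum>i\<in>?V. (norm (U (?c (p n) i) - ?c p0 i))\<^sup>2)" for n
    proof -
      have "norm ((norm (e n i))\<^sup>2) \<le> (\<Sum>i\<in>?V. (norm (e n i))\<^sup>2)"
        using member_le_sum[OF i, of "\<lambda>i. (norm (e n i))\<^sup>2"] V by simp
      then show ?thesis using best[OF U(1), of n] unfolding e_def by linarith
    qed
    have "(\<lambda>n. (norm (e n i))\<^sup>2) \<longlonglongrightarrow> 0"
      by (rule Lim_null_comparison[OF always_eventually[OF allI[OF bound]] to0])
    then have "(\<lambda>n. sqrt ((norm (e n i))\<^sup>2)) \<longlonglongrightarrow> sqrt 0" by (rule tendsto_real_sqrt)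
    then show ?thesis by (simp add: tendsto_norm_zero_iff)
  qed
  have e_nz: "\<exists>i\<in>?V. e n i \<noteq> 0" for n
  proof (rule ccontr)
    assume "\<not> ?thesis"
    then have "\<forall>i\<in>?V. R n (?c (p n) i) = ?c p0 i" by (simp add: e_def)
    then show False using contr R by blast
  qed
  have e_sum: "(\<Sum>i\<in>?V. e n i) = 0" for n
    by (simp add: e_def sum_subtractf sum_centered[OF V] linear_sum[OF linR, symmetric] linear_0[OF linR])
  \<comment> \<open>The aligned configuration satisfies the moment condition, and subtracting
    \<open>?c p0\<close> preserves it because the moment of \<open>?c p0\<close> with itself is
    symmetric.\<close>
  have e_sym: "(\<Sum>i\<in>?V. (e n i \<bullet> x) * (?c p0 i \<bullet> y)) = (\<Sum>i\<in>?V. (e n i \<bullet> y) * (?c p0 i \<bullet> x))" for n x y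
  proof -
    have "(\<Sum>i\<in>?V. (R n (?c (p n) i) \<bullet> x) * (?c p0 i \<bullet> y)) = (\<Sum>i\<in>?V. (R n (?c (p n) i) \<bullet> y) * (?c p0 i \<bullet> x))"
    proof (rule best_alignment_symmetric_moment)
      fix T :: "'a \<Rightarrow> 'a" assume T: "orthogonal_transformation T"
      show "(\<Sum>i\<in>?V. (norm (R n (?c (p n) i) - ?c p0 i))\<^sup>2)
          \<le> (\<Sum>i\<in>?V. (norm (T (R n (?c (p n) i)) - ?c p0 i))\<^sup>2)"
        using best[OF orthogonal_transformation_compose[OF T R]] by (simp add: o_def)
    qed
    then show ?thesis
      by (simp add: e_def inner_diff_left left_diff_distrib sum_subtractf)
        (simp add: mult.commute)
  qed
  \<comment> \<open>The aligning maps must converge as well, in order to follow the facet normals to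
    their limit.\<close>
  obtain T r where r: "strict_mono (r :: nat \<Rightarrow> nat)" and T: "orthogonal_transformation T"
    and limR: "\<And>x. (\<lambda>n. R (r n) x) \<longlonglongrightarrow> T x"
    using orthogonal_transformation_convergent_subsequence[of R] R by blast
  have linT: "linear T" using T orthogonal_transformation_linear by blast
  have innT: "T x \<bullet> T y = x \<bullet> y" for x y using T by (simp add: orthogonal_transformation_def)
  \<comment> \<open>As the maps preserve norms, their pointwise convergence carries over to
    convergent arguments.\<close>
  have limRx: "(\<lambda>n. R (r n) (x (r n))) \<longlonglongrightarrow> T l" if "x \<longlonglongrightarrow> l" for x l
  proof -
    have "(\<lambda>n. x (r n) - l) \<longlonglongrightarrow> 0"
      using LIMSEQ_subseq_LIMSEQ[OF that r] by (simp add: o_def LIM_zero)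
    then have "(\<lambda>n. norm (R (r n) (x (r n) - l))) \<longlonglongrightarrow> 0" by (simp add: normR tendsto_norm_zero_iff)
    then have "(\<lambda>n. R (r n) (x (r n) - l)) \<longlonglongrightarrow> 0" by (rule tendsto_norm_zero_cancel)
    from tendsto_add[OF this limR[of l]] show ?thesis by (simp add: linear_diff[OF linR])
  qed
  have T_q: "T (?c q i) = ?c p0 i" if i: "i \<in> ?V" for i
  proof (rule LIMSEQ_unique)
    show "(\<lambda>n. R (r n) (?c (p (r n)) i)) \<longlonglongrightarrow> T (?c q i)" by (intro limRx limc i)
    have "(\<lambda>n. e (r n) i + ?c p0 i) \<longlonglongrightarrow> 0 + ?c p0 i"
      using LIMSEQ_subseq_LIMSEQ[OF e_lim[OF i] r] by (intro tendsto_intros) (simp add: o_def)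
    then show "(\<lambda>n. R (r n) (?c (p (r n)) i)) \<longlonglongrightarrow> ?c p0 i" by (simp add: e_def)
  qed
  \<comment> \<open>denominator in the action of the isometry \<open>x \<mapsto> R (x - m p) + m p0\<close> on the polar vectors\<close>
  define D where "D n \<sigma> = 1 - m (p n) \<bullet> a n \<sigma> + m p0 \<bullet> R n (a n \<sigma>)" for n \<sigma>
  define D' where "D' \<sigma> = 1 - m q \<bullet> b \<sigma> + m p0 \<bullet> T (b \<sigma>)" for \<sigma>
  have limD: "(\<lambda>n. D (r n) \<sigma>) \<longlonglongrightarrow> D' \<sigma>" if \<sigma>: "\<sigma> \<in> ?F" for \<sigma>
    unfolding D_def D'_def
    using LIMSEQ_subseq_LIMSEQ[OF limm r] LIMSEQ_subseq_LIMSEQ[OF lima[OF \<sigma>] r] limRx[OF lima[OF \<sigma>]]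
    by (intro tendsto_intros) (auto simp: o_def)
  have D'_eq: "p0 i \<bullet> T (b \<sigma>) = D' \<sigma>" if "i \<in> ?V" "\<sigma> \<in> ?F" "incident K i \<sigma>" for i \<sigma>
  proof -
    have "p0 i = T (?c q i) + m p0" using T_q[OF that(1)] by (simp add: c)
    then have "p0 i \<bullet> T (b \<sigma>) = ?c q i \<bullet> b \<sigma> + m p0 \<bullet> T (b \<sigma>)"
      by (simp add: inner_add_left innT)
    then show ?thesis using inc_lim[OF that] by (simp add: D'_def c inner_diff_left)
  qed
  \<comment> \<open>If \<open>D' \<sigma>\<close> were zero, \<open>T (b \<sigma>)\<close> would be
    orthogonal to all vertices of the facet and so zero. Then no vertex could be incident to
    \<open>\<sigma>\<close>, and \<open>spanF\<close> would collapse the whole space.\<close>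
  have D'_nz: "D' \<sigma> \<noteq> 0" if \<sigma>: "\<sigma> \<in> ?F" for \<sigma>
  proof
    assume 0: "D' \<sigma> = 0"
    have "T (b \<sigma>) = 0"
      using D'_eq \<sigma> 0 by (intro spanF[OF \<sigma>]) (auto simp: inner_commute)
    then have "b \<sigma> = 0" using orthogonal_transformation_norm[OF T, of "b \<sigma>"] by simp
    then have "\<not> incident K i \<sigma>" if "i \<in> ?V" for i using inc_lim[OF that \<sigma>] by auto
    then have "z = 0" for z :: 'a using spanF[OF \<sigma>] by blast
    then show False using nonempty_Basis nonzero_Basis by blast
  qed
  \<comment> \<open>Both vectors have inner product 1 with every vertex of the facet, and
    \<open>spanF\<close> makes such a vector unique.\<close>
  have b_T: "T (b \<sigma>) /\<^sub>R D' \<sigma> = a0 \<sigma>" if \<sigma>: "\<sigma> \<in> ?F" for \<sigma>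
  proof -
    have "T (b \<sigma>) /\<^sub>R D' \<sigma> - a0 \<sigma> = 0"
    proof (rule spanF[OF \<sigma>])
      fix i assume i: "i \<in> ?V" "incident K i \<sigma>"
      have "p0 i \<bullet> (T (b \<sigma>) /\<^sub>R D' \<sigma> - a0 \<sigma>) = D' \<sigma> / D' \<sigma> - 1"
        using D'_eq[OF i(1) \<sigma> i(2)] inc0[OF i(1) \<sigma> i(2)] by (simp add: inner_diff_right divide_inverse mult.commute)
      then show "(T (b \<sigma>) /\<^sub>R D' \<sigma> - a0 \<sigma>) \<bullet> p0 i = 0"
        using D'_nz[OF \<sigma>] by (simp add: inner_commute)
    qed
    then show ?thesis by simp
  qed
  have "\<forall>\<^sub>F n in sequentially. \<forall>\<sigma>\<in>?F. D (r n) \<sigma> \<noteq> 0"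
    using F tendsto_imp_eventually_ne[OF limD D'_nz] by (intro eventually_ball_finite) auto
  then obtain N where N: "\<And>n \<sigma>. n \<ge> N \<Longrightarrow> \<sigma> \<in> ?F \<Longrightarrow> D (r n) \<sigma> \<noteq> 0"
    by (auto simp: eventually_sequentially)
  \<comment> \<open>The blow-up needs its constraints at every index, so the terms with a possibly
    zero denominator are dropped.\<close>
  define s where "s n = r (n + N)" for n
  have s: "strict_mono s" using r by (auto simp: s_def strict_mono_def)
  have Ds: "D (s n) \<sigma> \<noteq> 0" if "\<sigma> \<in> ?F" for n \<sigma> using N[OF _ that] by (simp add: s_def)
  \<comment> \<open>With \<open>\<delta>\<close> below, \<open>p0 + \<delta> n\<close> and
    \<open>a0 + \<beta> n\<close> form the transported copy of the realization with index
    \<open>s n\<close>.\<close>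
  define \<beta> where "\<beta> n \<sigma> = R (s n) (a (s n) \<sigma>) /\<^sub>R D (s n) \<sigma> - a0 \<sigma>" for n \<sigma>
  define \<delta> where "\<delta> n i = e (s n) i" for n i
  have p0_\<delta>: "p0 i + \<delta> n i = R (s n) (?c (p (s n)) i) + m p0" for n i
    by (simp add: \<delta>_def e_def c)
  have \<beta>_lim: "(\<lambda>n. \<beta> n \<sigma>) \<longlonglongrightarrow> 0" if \<sigma>: "\<sigma> \<in> ?F" for \<sigma>
  proof -
    have "(\<lambda>n. R (r n) (a (r n) \<sigma>) /\<^sub>R D (r n) \<sigma> - a0 \<sigma>) \<longlonglongrightarrow> T (b \<sigma>) /\<^sub>R D' \<sigma> - a0 \<sigma>"
      by (intro tendsto_intros limRx lima limD D'_nz \<sigma>)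
    from LIMSEQ_ignore_initial_segment[OF this, of N] show ?thesis
      by (simp add: \<beta>_def s_def b_T[OF \<sigma>])
  qed
  have \<delta>_lim: "(\<lambda>n. \<delta> n i) \<longlonglongrightarrow> 0" if "i \<in> ?V" for i
    using LIMSEQ_subseq_LIMSEQ[OF e_lim[OF that] s] by (simp add: \<delta>_def o_def)
  define E where "E = {(i, j). {i, j} \<in> edges K}"
  define I where "I = {(i, \<sigma>). i \<in> ?V \<and> \<sigma> \<in> ?F \<and> incident K i \<sigma>}"
  have \<delta>_edge: "2 * ((p0 i - p0 j) \<bullet> (\<delta> n i - \<delta> n j)) + (\<delta> n i - \<delta> n j) \<bullet> (\<delta> n i - \<delta> n j) = 0"
    if "(i, j) \<in> E" for n i j
  proof -
    have "(p0 i - p0 j) + (\<delta> n i - \<delta> n j) = R (s n) (?c (p (s n)) i - ?c (p (s n)) j)"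
      using p0_\<delta>[of i n] p0_\<delta>[of j n] by (simp add: linear_diff[OF linR] algebra_simps)
    then have "norm ((p0 i - p0 j) + (\<delta> n i - \<delta> n j)) = norm (p0 i - p0 j)"
      using len[of i j "s n"] that by (simp add: normR centered_diff E_def)
    then have "((p0 i - p0 j) + (\<delta> n i - \<delta> n j)) \<bullet> ((p0 i - p0 j) + (\<delta> n i - \<delta> n j))
        = (p0 i - p0 j) \<bullet> (p0 i - p0 j)"
      by (simp add: norm_eq)
    moreover have "(u + v) \<bullet> (u + v) = u \<bullet> u + (2 * (u \<bullet> v) + v \<bullet> v)" for u v :: 'a
      by (simp add: inner_add_left inner_add_right inner_commute)
    ultimately show ?thesis by (metis add_cancel_right_right)
  qed
  have \<delta>_inc: "p0 i \<bullet> \<beta> n \<sigma> + \<delta> n i \<bullet> a0 \<sigma> + \<delta> n i \<bullet> \<beta> n \<sigma> = 0" if "(i, \<sigma>) \<in> I" for n i \<sigma>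
  proof -
    have i: "i \<in> ?V" "\<sigma> \<in> ?F" "incident K i \<sigma>" using that by (auto simp: I_def)
    have "(p0 i + \<delta> n i) \<bullet> R (s n) (a (s n) \<sigma>) = D (s n) \<sigma>"
      unfolding p0_\<delta> using inc[OF i, of "s n"]
      by (simp add: inner_add_left innR c D_def inner_diff_left)
    then have "(p0 i + \<delta> n i) \<bullet> (a0 \<sigma> + \<beta> n \<sigma>) = 1"
      using Ds[OF i(2), of n] by (simp add: \<beta>_def)
    then show ?thesis using inc0[OF i] by (simp add: inner_add_left inner_add_right)
  qed
  have \<delta>_nz: "\<exists>i\<in>?V. \<delta> n i \<noteq> 0" for n using e_nz by (simp add: \<delta>_def)
  have sub: "E \<subseteq> ?V \<times> ?V" "I \<subseteq> ?V \<times> ?F" using edges by (auto simp: E_def I_def)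
  obtain r' t p' a' p'' a'' where
      p'_lim: "\<And>i. i \<in> ?V \<Longrightarrow> (\<lambda>n. \<delta> (r' n) i /\<^sub>R t n) \<longlonglongrightarrow> p' i"
    and motion: "\<forall>(i, j)\<in>E. (p0 i - p0 j) \<bullet> (p' i - p' j) = 0"
      "\<forall>(i, \<sigma>)\<in>I. p0 i \<bullet> a' \<sigma> + p' i \<bullet> a0 \<sigma> = 0"
      "\<forall>(i, j)\<in>E. (p0 i - p0 j) \<bullet> (p'' i - p'' j) + (p' i - p' j) \<bullet> (p' i - p' j) = 0"
      "\<forall>(i, \<sigma>)\<in>I. p0 i \<bullet> a'' \<sigma> + 2 * (p' i \<bullet> a' \<sigma>) + p'' i \<bullet> a0 \<sigma> = 0"
    and nontriv: "(\<exists>i\<in>?V. p' i \<noteq> 0) \<or> (\<exists>\<sigma>\<in>?F. a' \<sigma> \<noteq> 0)"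
    using second_order_blow_up[where p = p0 and a = a0 and \<delta> = \<delta> and \<beta> = \<beta>, OF V(1) F sub \<delta>_edge \<delta>_inc \<delta>_lim \<beta>_lim \<delta>_nz] by blast
  have "second_order_motion K (p0, a0) (p', a') (p'', a'')"
    using motion by (auto simp: second_order_motion_def first_order_motion_def E_def I_def)
  then have "trivial_first_order K (p0, a0) (p', a')"
    using rigid by (auto simp: second_order_rigid_def)
  then have triv: "(?c p0 i - ?c p0 j) \<bullet> (p' i - p' j) = 0" if "i \<in> ?V" "j \<in> ?V" for i j
    using that by (simp add: trivial_first_order_def centered_diff)
  \<comment> \<open>The zero sum and the symmetric moment are linear conditions, so they survive
    rescaling and limits.\<close>
  have p'_sum: "(\<Sum>i\<in>?V. p' i) = 0"
  proof (rule LIMSEQ_unique)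
    show "(\<lambda>n. \<Sum>i\<in>?V. \<delta> (r' n) i /\<^sub>R t n) \<longlonglongrightarrow> (\<Sum>i\<in>?V. p' i)"
      by (intro tendsto_intros p'_lim)
    show "(\<lambda>n. \<Sum>i\<in>?V. \<delta> (r' n) i /\<^sub>R t n) \<longlonglongrightarrow> 0"
      by (simp add: \<delta>_def e_sum scaleR_sum_right[symmetric])
  qed
  have p'_sym: "(\<Sum>i\<in>?V. (p' i \<bullet> x) * (?c p0 i \<bullet> y)) = (\<Sum>i\<in>?V. (p' i \<bullet> y) * (?c p0 i \<bullet> x))" for x y
  proof (rule LIMSEQ_unique)
    show "(\<lambda>n. \<Sum>i\<in>?V. ((\<delta> (r' n) i /\<^sub>R t n) \<bullet> x) * (?c p0 i \<bullet> y)) \<longlonglongrightarrow> (\<Sum>i\<in>?V. (p' i \<bullet> x) * (?c p0 i \<bullet> y))"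
      by (intro tendsto_intros p'_lim)
    have "(\<Sum>i\<in>?V. ((\<delta> (r' n) i /\<^sub>R t n) \<bullet> x) * (?c p0 i \<bullet> y))
        = (\<Sum>i\<in>?V. ((\<delta> (r' n) i /\<^sub>R t n) \<bullet> y) * (?c p0 i \<bullet> x))" for n
      using e_sym[of "s (r' n)" x y]
      by (simp add: \<delta>_def mult.assoc sum_distrib_left[symmetric])
    then show "(\<lambda>n. \<Sum>i\<in>?V. ((\<delta> (r' n) i /\<^sub>R t n) \<bullet> x) * (?c p0 i \<bullet> y)) \<longlonglongrightarrow> (\<Sum>i\<in>?V. (p' i \<bullet> y) * (?c p0 i \<bullet> x))"
      by (simp only:) (intro tendsto_intros p'_lim)
  qed
  have p'_0: "p' i = 0" if "i \<in> ?V" for i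
    by (rule symmetric_moment_trivial_imp_zero[OF V(1) sum_centered[OF V] p'_sum p'_sym triv spanV that])
  \<comment> \<open>With \<open>p' = 0\<close> on the vertices, the first-order incidence equations
    make \<open>a' \<sigma>\<close> orthogonal to the vertices of the facet.\<close>
  have "a' \<sigma> = 0" if "\<sigma> \<in> ?F" for \<sigma>
    using motion(2) that by (intro spanF[OF that]) (auto simp: I_def p'_0 inner_commute)
  then show False using nontriv p'_0 by blast
qed

section \<open>From the local statement to whole motions\<close>

text \<open>The interval \<open>{0..1}\<close> splits into the times \<open>A\<close> with an
  isometric copy and the times \<open>B\<close> without. Both sets are closed and
  \<open>0 \<in> A\<close>, so connectedness leaves \<open>B\<close> empty.\<close>

lemma second_order_rigid_imp_rigid:
  fixes p0 :: "'v \<Rightarrow> 'a::euclidean_space" and a0 :: "'f \<Rightarrow> 'a"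
  assumes V: "finite (verts K)" "verts K \<noteq> {}" and F: "finite (facets K)"
    and edges: "\<And>i j. {i, j} \<in> edges K \<Longrightarrow> i \<in> verts K \<and> j \<in> verts K"
    and spanV: "\<And>z. (\<And>i. i \<in> verts K \<Longrightarrow> z \<bullet> centered (verts K) p0 i = 0) \<Longrightarrow> z = 0"
    and spanF: "\<And>\<sigma> z. \<sigma> \<in> facets K \<Longrightarrow>
      (\<And>i. i \<in> verts K \<Longrightarrow> incident K i \<sigma> \<Longrightarrow> z \<bullet> p0 i = 0) \<Longrightarrow> z = 0"
    and rigid: "second_order_rigid K (p0, a0)"
  shows "rigid K (p0, a0)"
  unfolding rigid_def
proof (intro allI impI)
  fix \<gamma> assume motion: "motion K (p0, a0) \<gamma>"
  let ?c = "centered (verts K)"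
  define p where "p t = fst (\<gamma> t)" for t
  define a where "a t = snd (\<gamma> t)" for t
  have cont: "continuous_on {0..1} \<gamma>"
    using motion by (simp add: motion_def path_def)
  have real: "\<gamma> t \<in> realizations K" if "t \<in> {0..1}" for t
    using motion that unfolding motion_def path_image_def by blast
  have start: "\<gamma> 0 = (p0, a0)"
    using motion by (simp add: motion_def pathstart_def)
  have equiv: "equivalent K (\<gamma> t) (p0, a0)" if "t \<in> {0..1}" for t
    using motion that unfolding motion_def by blast
  have cont_p: "continuous_on {0..1} (\<lambda>t. p t i)" for i
    unfolding p_def by (rule continuous_on_product_then_coordinatewise[OF continuous_on_fst[OF cont]])
  have cont_a: "continuous_on {0..1} (\<lambda>t. a t \<sigma>)" for \<sigma>
    unfolding a_def by (rule continuous_on_product_then_coordinatewise[OF continuous_on_snd[OF cont]])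
  have p_lim: "(\<lambda>n. p (t n) i) \<longlonglongrightarrow> p s i" and a_lim: "(\<lambda>n. a (t n) \<sigma>) \<longlonglongrightarrow> a s \<sigma>"
    if "\<And>n. t n \<in> {0..1}" "t \<longlonglongrightarrow> s" "s \<in> {0..1}" for t :: "nat \<Rightarrow> real" and s i \<sigma>
    using cont_p[of i] cont_a[of \<sigma>] that unfolding continuous_on_sequentially by (auto simp: o_def)
  have inc: "p t i \<bullet> a t \<sigma> = 1"
    if "t \<in> {0..1}" "i \<in> verts K" "\<sigma> \<in> facets K" "incident K i \<sigma>" for t i \<sigma>
    using real[OF that(1)] that by (auto simp: realizations_def p_def a_def)
  have len: "norm (p t i - p t j) = norm (p0 i - p0 j)" if "t \<in> {0..1}" "{i, j} \<in> edges K" for t i j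
    using equiv[OF that(1)] that(2) by (simp add: equivalent_def p_def)
  have p_0: "p 0 = p0" "a 0 = a0" using start by (simp_all add: p_def a_def)
  define iso where "iso t \<longleftrightarrow> (\<exists>R. orthogonal_transformation R \<and>
      (\<forall>i\<in>verts K. R (?c (p t) i) = ?c p0 i))" for t
  define A where "A = {t\<in>{0..1}. iso t}"
  define B where "B = {t\<in>{0..1}. \<not> iso t}"
  have "closed A"
    unfolding closed_sequential_limits
  proof (intro allI impI, elim conjE)
    fix t s assume t: "\<forall>n. t n \<in> A" and lim: "t \<longlonglongrightarrow> s"
    have t01: "t n \<in> {0..1}" for n using t by (auto simp: A_def)
    have s01: "s \<in> {0..1}"
      using closed_sequentially[OF closed_atLeastAtMost _ lim] t01 by blast
    have "\<forall>n. \<exists>R. orthogonal_transformation R \<and> (\<forall>i\<in>verts K. R (?c (p (t n)) i) = ?c p0 i)"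
      using t by (auto simp: A_def iso_def)
    from choice[OF this] obtain R where R: "\<And>n. orthogonal_transformation (R n)"
      and Rc: "\<And>n i. i \<in> verts K \<Longrightarrow> R n (?c (p (t n)) i) = ?c p0 i" by blast
    obtain T r where r: "strict_mono (r :: nat \<Rightarrow> nat)" and T: "orthogonal_transformation T"
      and limR: "\<And>x. (\<lambda>n. R (r n) x) \<longlonglongrightarrow> T x"
      using orthogonal_transformation_convergent_subsequence[of R] R by blast
    have "T (?c (p s) i) = ?c p0 i" if i: "i \<in> verts K" for i
    proof (rule LIMSEQ_unique[OF limR])
      have "(\<lambda>n. ?c (p (t n)) i) \<longlonglongrightarrow> ?c (p s) i"
        by (intro tendsto_centered p_lim t01 lim s01 i)
      from LIMSEQ_subseq_LIMSEQ[OF this r]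
      have "(\<lambda>n. ?c (p (t (r n))) i - ?c (p s) i) \<longlonglongrightarrow> 0" by (simp add: o_def LIM_zero)
      \<comment> \<open>Applying the isometry \<open>R (r n)\<close> moves the error to the fixed
        argument \<open>?c (p s) i\<close>, where \<open>limR\<close> applies.\<close>
      moreover have "norm (?c (p (t (r n))) i - ?c (p s) i) = norm (R (r n) (?c (p s) i) - ?c p0 i)" for n
      proof -
        have "R (r n) (?c (p (t (r n))) i - ?c (p s) i) = ?c p0 i - R (r n) (?c (p s) i)"
          using R Rc[OF i] by (simp add: linear_diff orthogonal_transformation_linear)
        then show ?thesis
          using orthogonal_transformation_norm[OF R] by (metis norm_minus_commute)
      qed
      ultimately have "(\<lambda>n. R (r n) (?c (p s) i) - ?c p0 i) \<longlonglongrightarrow> 0"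
        by (simp add: tendsto_norm_zero_iff[symmetric, where f = "\<lambda>n. _ n - _"])
      then show "(\<lambda>n. R (r n) (?c (p s) i)) \<longlonglongrightarrow> ?c p0 i" by (rule LIM_zero_cancel)
    qed
    then show "s \<in> A" using T s01 by (auto simp: A_def iso_def)
  qed
  \<comment> \<open>A limit of non-isometric times cannot be isometric, since the local statement
    would produce an isometric term of the sequence.\<close>
  have "closed B"
    unfolding closed_sequential_limits
  proof (intro allI impI, elim conjE)
    fix t s assume t: "\<forall>n. t n \<in> B" and lim: "t \<longlonglongrightarrow> s"
    have t01: "t n \<in> {0..1}" for n using t by (auto simp: B_def)
    have s01: "s \<in> {0..1}"
      using closed_sequentially[OF closed_atLeastAtMost _ lim] t01 by blast
    have "\<not> iso s"
    proof
      assume "iso s"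
      then obtain U where U: "orthogonal_transformation U"
        "\<And>i. i \<in> verts K \<Longrightarrow> U (?c (p s) i) = ?c p0 i" by (auto simp: iso_def)
      have "\<exists>n R. orthogonal_transformation R \<and> (\<forall>i\<in>verts K. R (?c (p (t n)) i) = ?c p0 i)"
      proof (rule second_order_rigid_isometric_nearby[OF V F edges spanV spanF rigid _ _ _ _ _ U])
        show "p0 i \<bullet> a0 \<sigma> = 1" if "i \<in> verts K" "\<sigma> \<in> facets K" "incident K i \<sigma>" for i \<sigma>
          using inc[of 0, OF _ that] by (simp add: p_0)
        show "p (t n) i \<bullet> a (t n) \<sigma> = 1"
          if "i \<in> verts K" "\<sigma> \<in> facets K" "incident K i \<sigma>" for n i \<sigma>
          by (rule inc[OF t01 that])
        show "norm (p (t n) i - p (t n) j) = norm (p0 i - p0 j)" if "{i, j} \<in> edges K" for n i j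
          by (rule len[OF t01 that])
        show "(\<lambda>n. p (t n) i) \<longlonglongrightarrow> p s i" for i by (rule p_lim[OF t01 lim s01])
        show "(\<lambda>n. a (t n) \<sigma>) \<longlonglongrightarrow> a s \<sigma>" for \<sigma> by (rule a_lim[OF t01 lim s01])
      qed
      then show False using t by (auto simp: B_def iso_def)
    qed
    then show "s \<in> B" using s01 by (simp add: B_def)
  qed
  have "0 \<in> A"
    by (auto simp: A_def iso_def p_0 intro!: exI[of _ "\<lambda>x. x"])
  have "A \<inter> {0..1} = {} \<or> B \<inter> {0..1} = {}"
    by (rule connected_closedD[OF connected_Icc _ _ \<open>closed A\<close> \<open>closed B\<close>])
      (auto simp: A_def B_def)
  moreover have "A \<subseteq> {0..1}" "B \<subseteq> {0..1}" unfolding A_def B_def by blast+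
  ultimately have "B = {}" using \<open>0 \<in> A\<close> by blast
  show "trivial_motion K (p0, a0) \<gamma>"
    unfolding trivial_motion_def congruent_conf_def
  proof (intro ballI)
    fix t i j assume t: "t \<in> {0..1::real}" and ij: "i \<in> verts K" "j \<in> verts K"
    have "iso t" using \<open>B = {}\<close> t unfolding B_def by blast
    then obtain R where R: "orthogonal_transformation R"
      and Rc: "\<And>i. i \<in> verts K \<Longrightarrow> R (?c (p t) i) = ?c p0 i"
      unfolding iso_def by blast
    have "R (p t i - p t j) = R (?c (p t) i) - R (?c (p t) j)"
      by (simp only: linear_diff[OF orthogonal_transformation_linear[OF R], symmetric] centered_diff)
    also have "\<dots> = p0 i - p0 j" by (simp only: Rc ij centered_diff)
    finally have "norm (p t i - p t j) = norm (p0 i - p0 j)"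
      using orthogonal_transformation_norm[OF R] by metis
    then show "norm (fst (\<gamma> t) i - fst (\<gamma> t) j) = norm (fst (p0, a0) i - fst (p0, a0) j)"
      by (simp add: p_def)
  qed
qed

section \<open>Spanning properties of the vertices of a polytope\<close>

lemma polytope_eq_convex_hull_extreme_points:
  fixes P :: "'a::euclidean_space set"
  assumes "polytope P"
  shows "P = convex hull {x. x extreme_point_of P}"
  using assms by (intro Krein_Milman_Minkowski polytope_imp_compact polytope_imp_convex)

text \<open>The affine hull of a facet has codimension 1 and misses the origin, so adjoining the
  origin gives full dimension.\<close>

lemma span_facet_eq_UNIV:
  fixes P :: "'a::euclidean_space set"
  assumes P: "polytope P" and int: "0 \<in> interior P" and F: "\<sigma> facet_of P"
  shows "span \<sigma> = UNIV"
proof -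
  obtain a where a: "P \<subseteq> {x. a \<bullet> x \<le> 1}" "\<sigma> = P \<inter> {x. a \<bullet> x = 1}"
    using ex1_facet_normal[OF P int F] by blast
  have "aff_dim P = DIM('a)"
    using int by (metis aff_dim_nonempty_interior empty_iff)
  then have dim\<sigma>: "aff_dim \<sigma> = int DIM('a) - 1"
    using F by (simp add: facet_of_def)
  have "affine hull \<sigma> \<subseteq> {x. a \<bullet> x = 1}"
    using a(2) by (intro hull_minimal) (auto simp: affine_hyperplane)
  then have "0 \<notin> affine hull \<sigma>" by auto
  then have "aff_dim (insert 0 \<sigma>) = DIM('a)"
    using dim\<sigma> by (simp add: aff_dim_insert)
  then have "dim (insert 0 \<sigma>) = DIM('a)"
    by (simp add: aff_dim_zero hull_inc)
  then show ?thesis by (simp add: dim_eq_full)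
qed

text \<open>This supplies \<open>spanF\<close>: a facet is the convex hull of its own extreme
  points, which are extreme in \<open>P\<close>, and it spans the space.\<close>

lemma orthogonal_to_facet_vertices_eq_0:
  fixes P :: "'a::euclidean_space set"
  assumes P: "polytope P" and int: "0 \<in> interior P" and F: "\<sigma> facet_of P"
    and z: "\<And>x. x extreme_point_of P \<Longrightarrow> x \<in> \<sigma> \<Longrightarrow> z \<bullet> x = 0"
  shows "z = 0"
proof -
  have face: "\<sigma> face_of P" using F by (rule facet_of_imp_face_of)
  have "polytope \<sigma>" using face_of_polytope_polytope[OF P face] .
  then have "\<sigma> = convex hull {x. x extreme_point_of \<sigma>}"
    by (rule polytope_eq_convex_hull_extreme_points)
  also have "\<dots> \<subseteq> {x. z \<bullet> x = 0}"
    using z extreme_point_of_face[OF face] by (intro hull_minimal) (auto simp: convex_hyperplane)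
  finally have "span \<sigma> \<subseteq> {x. z \<bullet> x = 0}"
    by (intro span_minimal) (auto simp: subspace_hyperplane)
  then have "z \<in> {x. z \<bullet> x = 0}" using span_facet_eq_UNIV[OF P int F] by blast
  then show ?thesis by simp
qed

text \<open>This supplies \<open>spanV\<close>, with \<open>c\<close> the centroid: a nonzero
  \<open>z\<close> would confine \<open>P\<close> to a hyperplane, contradicting the interior
  point.\<close>

lemma orthogonal_to_vertex_differences_eq_0:
  fixes P :: "'a::euclidean_space set"
  assumes P: "polytope P" and int: "0 \<in> interior P"
    and z: "\<And>x. x extreme_point_of P \<Longrightarrow> z \<bullet> (x - c) = 0"
  shows "z = 0"
proof (rule ccontr)
  assume nz: "z \<noteq> 0"
  have "P = convex hull {x. x extreme_point_of P}"
    using P by (rule polytope_eq_convex_hull_extreme_points)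
  also have "\<dots> \<subseteq> {x. z \<bullet> x = z \<bullet> c}"
    using z by (intro hull_minimal) (auto simp: convex_hyperplane inner_diff_right)
  finally have "interior P \<subseteq> interior {x. z \<bullet> x = z \<bullet> c}" by (rule interior_mono)
  then show False using int interior_hyperplane[OF nz] by auto
qed

theorem theorem4p1:
  fixes P :: "(real ^ 'n) set"
  assumes "polytope P"
    and "aff_dim P = int CARD('n)"
    and "0 \<in> interior P"
    and "second_order_rigid (polytope_type P) (polytope_realization P)"
  shows "rigid (polytope_type P) (polytope_realization P)"
proof -
  let ?K = "polytope_type P" and ?V = "{x. x extreme_point_of P}"
  have V: "verts ?K = ?V" and F: "facets ?K = {\<sigma>. \<sigma> facet_of P}"
    and I: "incident ?K = (\<in>)"
    by (simp_all add: polytope_type_def)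
  have finV: "finite ?V"
    using assms(1) by (intro finite_polyhedron_extreme_points polytope_imp_polyhedron)
  have ne: "?V \<noteq> {}"
    using polytope_eq_convex_hull_extreme_points[OF assms(1)] assms(3) interior_subset by force
  have "rigid ?K (restrict (\<lambda>x. x) ?V, restrict (facet_normal P) {\<sigma>. \<sigma> facet_of P})"
  proof (rule second_order_rigid_imp_rigid)
    show "finite (verts ?K)" "verts ?K \<noteq> {}" using finV ne by (simp_all add: V)
    show "finite (facets ?K)" using finite_polytope_facets[OF assms(1)] by (simp add: F)
    show "i \<in> verts ?K \<and> j \<in> verts ?K" if "{i, j} \<in> edges ?K" for i j
      using that by (auto simp: polytope_type_def doubleton_eq_iff)
    show "z = 0" if "\<And>i. i \<in> verts ?K \<Longrightarrow> z \<bullet> centered (verts ?K) (restrict (\<lambda>x. x) ?V) i = 0" for z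
      by (rule orthogonal_to_vertex_differences_eq_0[OF assms(1,3)])
        (use that in \<open>auto simp: V centered_def\<close>)
    show "z = 0" if \<sigma>: "\<sigma> \<in> facets ?K"
      and "\<And>i. i \<in> verts ?K \<Longrightarrow> incident ?K i \<sigma> \<Longrightarrow> z \<bullet> restrict (\<lambda>x. x) ?V i = 0" for \<sigma> z
      by (rule orthogonal_to_facet_vertices_eq_0[OF assms(1,3)])
        (use that in \<open>auto simp: V F I\<close>)
    show "second_order_rigid ?K (restrict (\<lambda>x. x) ?V, restrict (facet_normal P) {\<sigma>. \<sigma> facet_of P})"
      using assms(4) by (simp add: polytope_realization_def)
  qed
  then show ?thesis by (simp add: polytope_realization_def)
qed

end
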